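(* Let $A$ and $B$ be finitely generated groups and let $G=A\wr B$ be their standard wreath product. Assume that $B$ is infinite and residually finite, and that $A$ has at least one non-trivial finite quotient. Then every finitely presented group $H$ admitting a surjective homomorphism onto $G$ has a finite index subgroup that admits a surjective homomorphism onto a non-abelian free group.
   Context: The standard wreath product is $A\wr B := A^{(B)}\rtimes B$, where $A^{(B)}=\bigoplus_{b\in B}A_b$ is the direct sum (finitely supported functions) of copies of $A$ indexed by $B$, and $B$ acts by permuting the copies via left multiplication on the index set $B$. *)

theory Defs
  imports "HOL-Algebra.Product_Groups"
begin

section \<open>Free groups as groups of reduced words\<close>

text \<open>A letter \<open>(x, True)\<close> stands for the generator \<open>x\<close> and \<open>(x, False)\<close> for its inverse.\<close>

type_synonym 'x letter = "'x \<times> bool"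

fun inv_letter :: "'x letter \<Rightarrow> 'x letter"
  where "inv_letter (x, e) = (x, \<not> e)"

definition reduced :: "'x letter list \<Rightarrow> bool"
  where "reduced w \<longleftrightarrow> successively (\<lambda>l m. m \<noteq> inv_letter l) w"

text \<open>Left multiplication of a reduced word by one letter.\<close>

fun push_letter :: "'x letter \<Rightarrow> 'x letter list \<Rightarrow> 'x letter list"
  where
    "push_letter l [] = [l]"
  | "push_letter l (m # w) = (if m = inv_letter l then w else l # m # w)"

text \<open>The product is the free reduction of the concatenation of two reduced words.\<close>

definition free_group :: "'x set \<Rightarrow> 'x letter list monoid"
  where "free_group X =
    \<lparr>carrier = {w. reduced w \<and> fst ` set w \<subseteq> X},
     monoid.mult = (\<lambda>u v. foldr push_letter u v),
     one = []\<rparr>"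

lemma inv_letter_inv_letter [simp]: "inv_letter (inv_letter l) = l"
  by (cases l) simp

lemma fst_inv_letter [simp]: "fst (inv_letter l) = fst l"
  by (cases l) simp

lemma inv_letter_eq_iff: "l = inv_letter m \<longleftrightarrow> m = inv_letter l"
  by auto

lemma inv_letter_neq [simp]: "inv_letter l \<noteq> l" "l \<noteq> inv_letter l"
  by (cases l; simp)+

lemma reduced_Nil [simp]: "reduced []"
  by (simp add: reduced_def)

lemma reduced_ConsD: "reduced (l # w) \<Longrightarrow> reduced w"
  by (auto simp: reduced_def successively_Cons)

lemma reduced_push_letter: "reduced w \<Longrightarrow> reduced (push_letter l w)"
  by (cases w) (auto simp: reduced_def successively_Cons)

lemma set_push_letter: "set (push_letter l w) \<subseteq> insert l (set w)"
  by (cases w) auto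

lemma push_letter_reduced: "reduced (l # w) \<Longrightarrow> push_letter l w = l # w"
  by (cases w) (auto simp: reduced_def)

lemma push_letter_cancel:
  assumes "reduced w"
  shows "push_letter l (push_letter (inv_letter l) w) = w"
proof (cases w)
  case Nil
  then show ?thesis by simp
next
  case (Cons m v)
  then show ?thesis
    using assms by (cases "m = l") (auto simp: push_letter_reduced)
qed

lemma reduced_foldr_push: "reduced v \<Longrightarrow> reduced (foldr push_letter u v)"
  by (induction u) (auto intro: reduced_push_letter)

lemma set_foldr_push: "set (foldr push_letter u v) \<subseteq> set u \<union> set v"
  using set_push_letter by (induction u) fastforce+

lemma foldr_push_Nil: "reduced u \<Longrightarrow> foldr push_letter u [] = u"
proof (induction u)
  case (Cons l u)
  then show ?case
    using reduced_ConsD push_letter_reduced by fastforce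
qed simp

lemma foldr_push_letter:
  assumes "reduced v" "reduced w"
  shows "foldr push_letter (push_letter l v) w = push_letter l (foldr push_letter v w)"
proof (cases v)
  case (Cons m u)
  have "push_letter l (push_letter (inv_letter l) (foldr push_letter u w)) = foldr push_letter u w"
    using assms(2) by (intro push_letter_cancel reduced_foldr_push)
  then show ?thesis
    using Cons by auto
qed simp

lemma foldr_push_assoc:
  assumes "reduced v" "reduced w"
  shows "foldr push_letter (foldr push_letter u v) w
       = foldr push_letter u (foldr push_letter v w)"
  by (induction u) (use assms in \<open>auto simp: foldr_push_letter reduced_foldr_push\<close>)

lemma reduced_rev_inv:
  assumes "reduced w"
  shows "reduced (rev (map inv_letter w))"
  using assms unfolding reduced_def successively_rev successively_map
  by (rule successively_mono) (metis inv_letter_inv_letter)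

lemma foldr_push_rev_inv:
  "reduced v \<Longrightarrow> foldr push_letter (rev (map inv_letter w)) (foldr push_letter w v) = v"
proof (induction w)
  case (Cons l w)
  then show ?case
    using push_letter_cancel[of "foldr push_letter w v" "inv_letter l"]
    by (simp add: reduced_foldr_push)
qed simp

theorem group_free_group: "group (free_group X)"
proof (rule groupI)
  fix u v assume "u \<in> carrier (free_group X)" "v \<in> carrier (free_group X)"
  then show "u \<otimes>\<^bsub>free_group X\<^esub> v \<in> carrier (free_group X)"
    using set_foldr_push[of u v] by (force simp: free_group_def reduced_foldr_push)
next
  fix u assume u: "u \<in> carrier (free_group X)"
  have "rev (map inv_letter u) \<in> carrier (free_group X)"
    using u by (auto simp: free_group_def reduced_rev_inv)
  moreover have "rev (map inv_letter u) \<otimes>\<^bsub>free_group X\<^esub> u = \<one>\<^bsub>free_group X\<^esub>"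
    using u foldr_push_rev_inv[of "[]" u] by (simp add: free_group_def foldr_push_Nil)
  ultimately show "\<exists>v\<in>carrier (free_group X). v \<otimes>\<^bsub>free_group X\<^esub> u = \<one>\<^bsub>free_group X\<^esub>"
    by blast
qed (auto simp: free_group_def foldr_push_assoc)


section \<open>Finiteness conditions on groups\<close>

definition finitely_generated :: "('a, 'm) monoid_scheme \<Rightarrow> bool"
  where "finitely_generated G \<longleftrightarrow>
    (\<exists>S. finite S \<and> S \<subseteq> carrier G \<and> generate G S = carrier G)"

definition normal_closure :: "('a, 'm) monoid_scheme \<Rightarrow> 'a set \<Rightarrow> 'a set"
  where "normal_closure G R =
    generate G {g \<otimes>\<^bsub>G\<^esub> r \<otimes>\<^bsub>G\<^esub> inv\<^bsub>G\<^esub> g | g r. g \<in> carrier G \<and> r \<in> R}"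

lemma (in group) normal_closure_normal:
  assumes R: "R \<subseteq> carrier G"
  shows "normal_closure G R \<lhd> G"
  unfolding normal_closure_def
proof (rule normal_generateI)
  fix h x
  assume "h \<in> {g \<otimes> r \<otimes> inv g | g r. g \<in> carrier G \<and> r \<in> R}" and x: "x \<in> carrier G"
  then obtain g r where g: "g \<in> carrier G" and r: "r \<in> R" and h: "h = g \<otimes> r \<otimes> inv g"
    by blast
  have "x \<otimes> h \<otimes> inv x = (x \<otimes> g) \<otimes> r \<otimes> inv (x \<otimes> g)"
    using g r x R by (simp add: h m_assoc inv_mult_group subset_iff)
  then show "x \<otimes> h \<otimes> inv x \<in> {g \<otimes> r \<otimes> inv g | g r. g \<in> carrier G \<and> r \<in> R}"
    using g r x by blast
qed (use R in auto)

definition finitely_presented :: "('a, 'm) monoid_scheme \<Rightarrow> bool"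
  where "finitely_presented G \<longleftrightarrow>
    (\<exists>(n::nat) R. finite R \<and> R \<subseteq> carrier (free_group {..<n}) \<and>
       G \<cong> free_group {..<n} Mod normal_closure (free_group {..<n}) R)"

definition finite_index :: "'a set \<Rightarrow> ('a, 'm) monoid_scheme \<Rightarrow> bool"
  where "finite_index K G \<longleftrightarrow> subgroup K G \<and> finite (rcosets\<^bsub>G\<^esub> K)"

definition residually_finite :: "('a, 'm) monoid_scheme \<Rightarrow> bool"
  where "residually_finite G \<longleftrightarrow>
    (\<forall>g\<in>carrier G. g \<noteq> \<one>\<^bsub>G\<^esub> \<longrightarrow> (\<exists>N. N \<lhd> G \<and> finite_index N G \<and> g \<notin> N))"


section \<open>Wreath products\<close>

definition semidirect_product ::
    "('n, 'k) monoid_scheme \<Rightarrow> ('q, 'm) monoid_scheme \<Rightarrow> ('q \<Rightarrow> 'n \<Rightarrow> 'n) \<Rightarrow> ('n \<times> 'q) monoid"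
  where "semidirect_product N Q \<phi> =
    \<lparr>carrier = carrier N \<times> carrier Q,
     monoid.mult = (\<lambda>(f, b) (g, c). (f \<otimes>\<^bsub>N\<^esub> \<phi> b g, b \<otimes>\<^bsub>Q\<^esub> c)),
     one = (\<one>\<^bsub>N\<^esub>, \<one>\<^bsub>Q\<^esub>)\<rparr>"

text \<open>Left translation of the index set moves the copy indexed by \<open>x\<close> to the copy indexed by
  \<open>b \<otimes> x\<close>; on functions this is precomposition with left multiplication by the inverse of \<open>b\<close>.\<close>

definition shift :: "('b, 'm) monoid_scheme \<Rightarrow> 'b \<Rightarrow> ('b \<Rightarrow> 'a) \<Rightarrow> ('b \<Rightarrow> 'a)"
  where "shift B b f = (\<lambda>x\<in>carrier B. f (inv\<^bsub>B\<^esub> b \<otimes>\<^bsub>B\<^esub> x))"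

definition wreath_product ::
    "('a, 'k) monoid_scheme \<Rightarrow> ('b, 'm) monoid_scheme \<Rightarrow> (('b \<Rightarrow> 'a) \<times> 'b) monoid"
  where "wreath_product A B =
    semidirect_product (sum_group (carrier B) (\<lambda>_. A)) B (shift B)"

lemma shift_closed:
  assumes A: "group A" and B: "group B" and b: "b \<in> carrier B"
    and f: "f \<in> carrier (sum_group (carrier B) (\<lambda>_. A))"
  shows "shift B b f \<in> carrier (sum_group (carrier B) (\<lambda>_. A))"
proof -
  interpret B: group B by (rule B)
  have fin: "finite {x \<in> carrier B. f x \<noteq> \<one>\<^bsub>A\<^esub>}" and fA: "f \<in> carrier B \<rightarrow>\<^sub>E carrier A"
    using f A by (auto simp: carrier_sum_group)
  have "{x \<in> carrier B. shift B b f x \<noteq> \<one>\<^bsub>A\<^esub>}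
      \<subseteq> (\<lambda>x. b \<otimes>\<^bsub>B\<^esub> x) ` {x \<in> carrier B. f x \<noteq> \<one>\<^bsub>A\<^esub>}"
  proof
    fix x assume x: "x \<in> {x \<in> carrier B. shift B b f x \<noteq> \<one>\<^bsub>A\<^esub>}"
    then have "x = b \<otimes>\<^bsub>B\<^esub> (inv\<^bsub>B\<^esub> b \<otimes>\<^bsub>B\<^esub> x)"
      using b by (simp add: B.m_assoc[symmetric])
    then show "x \<in> (\<lambda>x. b \<otimes>\<^bsub>B\<^esub> x) ` {x \<in> carrier B. f x \<noteq> \<one>\<^bsub>A\<^esub>}"
      using x b by (intro image_eqI) (auto simp: shift_def)
  qed
  then have "finite {x \<in> carrier B. shift B b f x \<noteq> \<one>\<^bsub>A\<^esub>}"
    using fin finite_surj by blast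
  moreover have "shift B b f \<in> carrier B \<rightarrow>\<^sub>E carrier A"
    using fA b by (auto simp: shift_def PiE_iff)
  ultimately show ?thesis
    using A by (simp add: carrier_sum_group)
qed

theorem group_wreath_product:
  assumes A: "group A" and B: "group B"
  shows "group (wreath_product A B)"
proof -
  interpret A: group A by (rule A)
  interpret B: group B by (rule B)
  define N where "N = sum_group (carrier B) (\<lambda>_. A)"
  interpret N: group N unfolding N_def by (rule sum_group) (rule A)
  note sh = shift_closed[OF A B, folded N_def]
  have NA: "f x \<in> carrier A" if "f \<in> carrier N" "x \<in> carrier B" for f x
    using that A by (auto simp: N_def carrier_sum_group)
  have multN: "f \<otimes>\<^bsub>N\<^esub> g = (\<lambda>x\<in>carrier B. f x \<otimes>\<^bsub>A\<^esub> g x)" for f g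
    by (simp add: N_def)
  have sh_mult: "shift B b (f \<otimes>\<^bsub>N\<^esub> g) = shift B b f \<otimes>\<^bsub>N\<^esub> shift B b g" if "b \<in> carrier B" for b f g
    using that by (auto simp: multN shift_def fun_eq_iff)
  have sh_sh: "shift B b (shift B c f) = shift B (b \<otimes>\<^bsub>B\<^esub> c) f"
    if "b \<in> carrier B" "c \<in> carrier B" for b c f
    using that by (auto simp: shift_def fun_eq_iff B.inv_mult_group B.m_assoc)
  have sh_one: "shift B \<one>\<^bsub>B\<^esub> f = f" if "f \<in> carrier N" for f
  proof -
    have "f \<in> carrier B \<rightarrow>\<^sub>E carrier A"
      using that A by (auto simp: N_def carrier_sum_group)
    then show ?thesis
      by (auto simp: shift_def PiE_iff extensional_def)
  qed
  have W: "wreath_product A B = semidirect_product N B (shift B)"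
    by (simp add: wreath_product_def N_def)
  show ?thesis
    unfolding W
  proof (rule groupI)
    fix x assume x: "x \<in> carrier (semidirect_product N B (shift B))"
    then obtain f b where fb: "x = (f, b)" "f \<in> carrier N" "b \<in> carrier B"
      by (auto simp: semidirect_product_def)
    define y where "y = (shift B (inv\<^bsub>B\<^esub> b) (inv\<^bsub>N\<^esub> f), inv\<^bsub>B\<^esub> b)"
    have "shift B (inv\<^bsub>B\<^esub> b) \<one>\<^bsub>N\<^esub> = \<one>\<^bsub>N\<^esub>"
      using fb by (auto simp: N_def shift_def fun_eq_iff)
    then have "y \<otimes>\<^bsub>semidirect_product N B (shift B)\<^esub> x = \<one>\<^bsub>semidirect_product N B (shift B)\<^esub>"
      using fb by (simp add: y_def semidirect_product_def flip: sh_mult)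
    moreover have "y \<in> carrier (semidirect_product N B (shift B))"
      using fb by (simp add: y_def semidirect_product_def sh)
    ultimately show "\<exists>y\<in>carrier (semidirect_product N B (shift B)).
        y \<otimes>\<^bsub>semidirect_product N B (shift B)\<^esub> x = \<one>\<^bsub>semidirect_product N B (shift B)\<^esub>"
      by blast
  qed (auto simp: semidirect_product_def sh sh_mult sh_sh sh_one N.m_assoc B.m_assoc)
qed

end

theory Submission
  imports Defs "HOL-Algebra.Bij"
begin

text \<open>
  Since \<open>H\<close> is finitely presented, composing \<open>H \<rightarrow> A \<wr> B\<close> with a map \<open>\<Psi>\<close> of \<open>A \<wr> B\<close> into another group
  gives a homomorphism on generators as soon as \<open>\<Psi>\<close> is multiplicative on the finitely many products
  occurring in the relators.  These involve only a finite set \<open>S \<subseteq> B\<close> of coordinates.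

  Let \<open>\<alpha> : A \<rightarrow> Q\<close> be a non-trivial finite quotient.  Choose \<open>b\<^sub>0, b\<^sub>1, b\<^sub>2 \<in> B\<close> and a finite quotient
  \<open>\<beta> : B \<rightarrow> P\<close>, injective on \<open>S\<close>, such that no translate of \<open>{\<beta> b\<^sub>0, \<beta> b\<^sub>1, \<beta> b\<^sub>2}\<close> meets \<open>\<beta> S\<close> in more
  than one point.  Two coordinates in \<open>S\<close> then never act in the same fibre over \<open>P\<close> when \<open>\<Psi>\<close> is defined
  by permutations of \<open>P \<times> Q \<times> \<Phi>\<close>, with \<open>\<Phi>\<close> free of rank two, as follows: over \<open>p\<close>, an element \<open>q\<close> in the
  coordinate lying over \<open>p \<beta>(b\<^sub>i)\<close> acts by \<open>y\<^sub>i q y\<^sub>i\<inverse>\<close>, where \<open>q\<close> translates \<open>Q\<close> and \<open>y\<^sub>i : Q \<rightarrow> \<Phi>\<close> acts as a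
  gauge transformation.  (For generic \<open>y\<^sub>i\<close> the three conjugates of \<open>Q\<close> generate the virtually free group
  \<open>Q * Q * Q\<close>.)  The stabiliser of a point of \<open>P \<times> Q\<close> has finite index and maps to \<open>\<Phi>\<close>, onto for a
  suitable choice of the \<open>y\<^sub>i\<close>.
\<close>

section \<open>Homomorphisms out of free and finitely presented groups\<close>

fun letter_val :: "('g, 'm) monoid_scheme \<Rightarrow> ('x \<Rightarrow> 'g) \<Rightarrow> 'x letter \<Rightarrow> 'g"
  where "letter_val G a (x, e) = (if e then a x else inv\<^bsub>G\<^esub> a x)"

definition word_val :: "('g, 'm) monoid_scheme \<Rightarrow> ('x \<Rightarrow> 'g) \<Rightarrow> 'x letter list \<Rightarrow> 'g"
  where "word_val G a w = foldr (\<lambda>l. (\<otimes>\<^bsub>G\<^esub>) (letter_val G a l)) w \<one>\<^bsub>G\<^esub>"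

lemma word_val_simps [simp]:
  "word_val G a [] = \<one>\<^bsub>G\<^esub>"
  "word_val G a (l # w) = letter_val G a l \<otimes>\<^bsub>G\<^esub> word_val G a w"
  by (simp_all add: word_val_def)

lemma carrier_free_group: "carrier (free_group X) = {w. reduced w \<and> fst ` set w \<subseteq> X}"
  by (simp add: free_group_def)

lemma mult_free_group: "u \<otimes>\<^bsub>free_group X\<^esub> v = foldr push_letter u v"
  by (simp add: free_group_def)

lemma one_free_group: "\<one>\<^bsub>free_group X\<^esub> = []"
  by (simp add: free_group_def)

lemma singleton_in_free_group: "[l] \<in> carrier (free_group X) \<longleftrightarrow> fst l \<in> X"
  by (simp add: carrier_free_group reduced_def)

lemma inv_free_group_singleton:
  assumes "fst l \<in> X"
  shows "inv\<^bsub>free_group X\<^esub> [l] = [inv_letter l]"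
proof -
  interpret group "free_group X" by (rule group_free_group)
  show ?thesis
    using assms by (intro inv_equality) (auto simp: singleton_in_free_group mult_free_group one_free_group)
qed

lemma Cons_free_group:
  assumes "l # w \<in> carrier (free_group X)"
  shows "l # w = [l] \<otimes>\<^bsub>free_group X\<^esub> w" "[l] \<in> carrier (free_group X)" "w \<in> carrier (free_group X)"
  using assms by (auto simp: carrier_free_group mult_free_group push_letter_reduced reduced_def
      dest: reduced_ConsD[unfolded reduced_def])

context group
begin

lemma letter_val_closed [simp]:
  "a \<in> X \<rightarrow> carrier G \<Longrightarrow> fst l \<in> X \<Longrightarrow> letter_val G a l \<in> carrier G"
  by (cases l) auto

lemma word_val_closed [simp]:
  "a \<in> X \<rightarrow> carrier G \<Longrightarrow> fst ` set w \<subseteq> X \<Longrightarrow> word_val G a w \<in> carrier G"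
  by (induction w) auto

lemma letter_val_inv_letter:
  "a \<in> X \<rightarrow> carrier G \<Longrightarrow> fst l \<in> X \<Longrightarrow> letter_val G a (inv_letter l) = inv (letter_val G a l)"
  by (cases l) (auto simp: Pi_iff)

lemma word_val_push_letter:
  assumes a: "a \<in> X \<rightarrow> carrier G" and l: "fst l \<in> X" and w: "fst ` set w \<subseteq> X"
  shows "word_val G a (push_letter l w) = letter_val G a l \<otimes> word_val G a w"
proof (cases w)
  case (Cons m v)
  have "letter_val G a l \<otimes> (inv (letter_val G a l) \<otimes> word_val G a v) = word_val G a v"
    using a l w Cons by (simp add: m_assoc[symmetric])
  then show ?thesis
    using Cons letter_val_inv_letter[OF a l] by auto
qed simp

lemma word_val_foldr_push:
  assumes a: "a \<in> X \<rightarrow> carrier G" and u: "fst ` set u \<subseteq> X" and v: "fst ` set v \<subseteq> X"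
  shows "word_val G a (foldr push_letter u v) = word_val G a u \<otimes> word_val G a v"
  using u
proof (induction u)
  case (Cons l u)
  have "fst ` set (foldr push_letter u v) \<subseteq> X"
    using set_foldr_push[of u v] Cons.prems v by fastforce
  then show ?case
    using Cons a v by (simp add: word_val_push_letter m_assoc)
qed (use a v in auto)

text \<open>Existence half of the universal property of the free group: the cancellations made by
  \<open>push_letter\<close> do not change the value, since adjacent inverse letters multiply to the
  identity.\<close>

lemma word_val_hom:
  assumes "a \<in> X \<rightarrow> carrier G"
  shows "word_val G a \<in> hom (free_group X) G"
  using assms by (auto intro!: homI simp: carrier_free_group mult_free_group word_val_foldr_push)

end

text \<open>Uniqueness half of the universal property: a reduced word is the product of its letters,
  so the images of the generators decide everything.\<close>

lemma hom_free_group_eq_word_val: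
  assumes G: "group G" and f: "f \<in> hom (free_group X) G" and w: "w \<in> carrier (free_group X)"
  shows "f w = word_val G (\<lambda>x. f [(x, True)]) w"
proof -
  interpret F: group "free_group X" by (rule group_free_group)
  interpret f: group_hom "free_group X" G f
    using G f by (simp add: group_hom_def group_hom_axioms_def F.is_group)
  have letter: "f [l] = letter_val G (\<lambda>x. f [(x, True)]) l" if "fst l \<in> X" for l
  proof (cases l)
    case (Pair x e)
    then show ?thesis
      using that f.hom_inv[of "[(x, True)]"] inv_free_group_singleton[of "(x, True)" X]
      by (simp add: singleton_in_free_group)
  qed
  show ?thesis
    using w
  proof (induction w)
    case Nil
    then show ?case using f.hom_one by (simp add: one_free_group)
  next
    case (Cons l w)
    note * = Cons_free_group[OF Cons.prems]
    show ?case
      using Cons.IH[OF *(3)] letter[of l] *(2) f.hom_mult[OF *(2,3), folded *(1)]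
      by (simp add: singleton_in_free_group)
  qed
qed

text \<open>Reduces surjectivity onto a free group to hitting the generators; words are rebuilt from
  the right, one letter at a time.\<close>

lemma free_group_subgroup_eq:
  assumes L: "subgroup L (free_group X)" and gens: "\<And>x. x \<in> X \<Longrightarrow> [(x, True)] \<in> L"
  shows "L = carrier (free_group X)"
proof
  interpret L: subgroup L "free_group X" by (rule L)
  interpret F: group "free_group X" by (rule group_free_group)
  show "L \<subseteq> carrier (free_group X)" by (rule L.subset)
  have letter: "[l] \<in> L" if "fst l \<in> X" for l
  proof (cases l)
    case (Pair x e)
    then show ?thesis
      using that gens[of x] L.m_inv_closed[of "[(x, True)]"] inv_free_group_singleton[of "(x, True)" X]
      by (cases e) auto
  qed
  show "carrier (free_group X) \<subseteq> L"
  proof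
    fix w assume "w \<in> carrier (free_group X)"
    then show "w \<in> L"
    proof (induction w)
      case Nil
      then show ?case using L.one_closed by (simp add: one_free_group)
    next
      case (Cons l w)
      note * = Cons_free_group[OF Cons.prems]
      show ?case
        using L.m_closed[OF letter Cons.IH[OF *(3)]] *(1,2) by (simp add: singleton_in_free_group)
    qed
  qed
qed

lemma free_group_not_comm:
  assumes "x \<in> X" "y \<in> X" "x \<noteq> y"
  shows "\<not> comm_group (free_group X)"
proof
  assume "comm_group (free_group X)"
  then interpret comm_group "free_group X" .
  show False
    using m_comm[of "[(x, True)]" "[(y, True)]"] assms
    by (simp add: singleton_in_free_group mult_free_group)
qed

section \<open>Presentations: descending homomorphisms to quotients of free groups\<close>

lemma hom_factor_through_epi:
  assumes "group F" "group H" "group W"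
    and \<rho>: "\<rho> \<in> epi F H" and f: "f \<in> hom F W"
    and ker: "kernel F H \<rho> \<subseteq> kernel F W f"
  obtains \<theta> where "\<theta> \<in> hom H W" "\<And>w. w \<in> carrier F \<Longrightarrow> \<theta> (\<rho> w) = f w"
proof -
  interpret \<rho>: group_hom F H \<rho>
    using assms by (simp add: group_hom_def group_hom_axioms_def epi_def)
  interpret f: group_hom F W f
    using assms by (simp add: group_hom_def group_hom_axioms_def)
  \<comment> \<open>The preimage picked by \<open>inv_into\<close> is arbitrary; \<open>eq\<close>
    shows that \<open>f\<close> is constant on the fibres of \<open>\<rho>\<close>, so the choice
    does not matter.\<close>
  define \<theta> where "\<theta> h = f (inv_into (carrier F) \<rho> h)" for h
  have eq: "f u = f v" if u: "u \<in> carrier F" and v: "v \<in> carrier F" and "\<rho> u = \<rho> v" for u v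
  proof -
    have "u \<otimes>\<^bsub>F\<^esub> inv\<^bsub>F\<^esub> v \<in> kernel F H \<rho>"
      using that by (simp add: kernel_def)
    then have "u \<otimes>\<^bsub>F\<^esub> inv\<^bsub>F\<^esub> v \<in> kernel F W f"
      using ker by blast
    then have "f u \<otimes>\<^bsub>W\<^esub> inv\<^bsub>W\<^esub> f v = \<one>\<^bsub>W\<^esub>"
      using u v by (simp add: kernel_def)
    then show ?thesis
      using u v by (metis f.H.inv_closed f.H.inv_equality f.H.inv_inv f.hom_closed)
  qed
  have surj: "\<rho> ` carrier F = carrier H"
    using \<rho> by (simp add: epi_def)
  have \<theta>: "\<theta> (\<rho> w) = f w" if "w \<in> carrier F" for w
    unfolding \<theta>_def using that by (intro eq) (auto intro: inv_into_into f_inv_into_f)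
  have "\<theta> \<in> hom H W"
  proof (rule homI)
    fix x assume "x \<in> carrier H"
    then show "\<theta> x \<in> carrier W"
      using surj \<theta> by (metis f.hom_closed imageE)
  next
    fix x y assume "x \<in> carrier H" "y \<in> carrier H"
    then obtain u v where uv: "u \<in> carrier F" "v \<in> carrier F" "x = \<rho> u" "y = \<rho> v"
      using surj by (metis imageE)
    then have "\<theta> (\<rho> (u \<otimes>\<^bsub>F\<^esub> v)) = f u \<otimes>\<^bsub>W\<^esub> f v"
      using \<theta>[of "u \<otimes>\<^bsub>F\<^esub> v"] by simp
    then show "\<theta> (x \<otimes>\<^bsub>H\<^esub> y) = \<theta> x \<otimes>\<^bsub>W\<^esub> \<theta> y"
      using uv \<theta> by simp
  qed
  then show thesis
    using \<theta> that by blast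
qed

text \<open>A kernel is closed under conjugation and products, so it suffices to check the relators
  themselves.\<close>

lemma (in group_hom) normal_closure_subset_kernel:
  assumes "R \<subseteq> kernel G H h"
  shows "normal_closure G R \<subseteq> kernel G H h"
  unfolding normal_closure_def
proof (rule G.generate_subgroup_incl[OF _ subgroup_kernel])
  show "{g \<otimes>\<^bsub>G\<^esub> r \<otimes>\<^bsub>G\<^esub> inv\<^bsub>G\<^esub> g |g r. g \<in> carrier G \<and> r \<in> R} \<subseteq> kernel G H h"
    using assms by (auto simp: kernel_def)
qed

text \<open>Turns the isomorphism in the definition into a presentation map: \<open>\<rho>\<close>
  is the projection onto the quotient followed by the isomorphism \<open>j\<close>, whose
  injectivity identifies the kernel.\<close>

lemma finitely_presented_epi:
  assumes H: "group H" and fp: "finitely_presented H"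
  obtains n :: nat and R \<rho> where "finite R" "R \<subseteq> carrier (free_group {..<n})"
    "\<rho> \<in> epi (free_group {..<n}) H"
    "kernel (free_group {..<n}) H \<rho> = normal_closure (free_group {..<n}) R"
proof -
  from fp obtain n :: nat and R where R: "finite R" "R \<subseteq> carrier (free_group {..<n})"
    and iso: "H \<cong> free_group {..<n} Mod normal_closure (free_group {..<n}) R"
    unfolding finitely_presented_def by blast
  define F where "F = free_group {..<n}"
  define N where "N = normal_closure F R"
  interpret F: group F unfolding F_def by (rule group_free_group)
  interpret N: normal N F
    unfolding N_def using R(2) by (intro F.normal_closure_normal) (simp add: F_def)
  have "F Mod N \<cong> H"
    using iso H by (simp add: F_def N_def group.iso_sym)
  then obtain j where j: "j \<in> iso (F Mod N) H"
    unfolding is_iso_def by blast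
  interpret j: group_hom "F Mod N" H j
    using j H by (simp add: group_hom_def group_hom_axioms_def N.factorgroup_is_group iso_imp_homomorphism)
  define \<rho> where "\<rho> = j \<circ> (\<lambda>w. N #>\<^bsub>F\<^esub> w)"
  have surj: "j ` carrier (F Mod N) = carrier H" and inj: "inj_on j (carrier (F Mod N))"
    using j by (auto simp: iso_def bij_betw_def)
  have "\<rho> ` carrier F = carrier H"
    using surj by (simp add: \<rho>_def carrier_FactGroup image_comp)
  moreover have "\<rho> \<in> hom F H"
    unfolding \<rho>_def by (rule hom_compose[OF N.r_coset_hom_Mod j.homh])
  ultimately have epi: "\<rho> \<in> epi F H"
    by (simp add: epi_def)
  have "w \<in> kernel F H \<rho> \<longleftrightarrow> w \<in> N" for w
  proof (cases "w \<in> carrier F")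
    case True
    then have "N #>\<^bsub>F\<^esub> w \<in> carrier (F Mod N)"
      by (auto simp: carrier_FactGroup)
    then have "\<rho> w = \<one>\<^bsub>H\<^esub> \<longleftrightarrow> N #>\<^bsub>F\<^esub> w = N"
      using inj_onD[OF inj, of "N #>\<^bsub>F\<^esub> w" "\<one>\<^bsub>F Mod N\<^esub>"] j.G.one_closed j.hom_one
      by (auto simp: \<rho>_def)
    then show ?thesis
      using True F.coset_join1[OF _ _ N.is_subgroup] F.coset_join2[OF _ N.is_subgroup]
      by (auto simp: kernel_def N.subset)
  next
    case False
    then show ?thesis
      using N.subset by (auto simp: kernel_def)
  qed
  then have "kernel F H \<rho> = N"
    by blast
  then show thesis
    using that R epi unfolding F_def N_def by blast
qed

text \<open>The set \<open>E\<close> consists of the products met while evaluating, letter by letter, the relators and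
  chosen words for the elements of \<open>C\<close>.\<close>

lemma finitely_presented_local_hom:
  fixes H :: "('h, 'm) monoid_scheme" and G :: "('g, 'n) monoid_scheme"
  assumes H: "group H" and fp: "finitely_presented H" and G: "group G"
    and \<eta>: "\<eta> \<in> epi H G" and C: "finite C" "C \<subseteq> carrier G"
  obtains E where "finite E" "E \<subseteq> carrier G \<times> carrier G"
    "\<forall>(W :: ('w, 'k) monoid_scheme) \<Psi>. group W \<longrightarrow> \<Psi> \<in> carrier G \<rightarrow> carrier W \<longrightarrow>
        (\<forall>(x, y)\<in>E. \<Psi> (x \<otimes>\<^bsub>G\<^esub> y) = \<Psi> x \<otimes>\<^bsub>W\<^esub> \<Psi> y) \<longrightarrow>
        (\<exists>\<theta>\<in>hom H W. \<forall>c\<in>C. \<exists>h\<in>carrier H. \<eta> h = c \<and> \<theta> h = \<Psi> c)"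
proof -
  obtain n :: nat and R \<rho> where R: "finite R" "R \<subseteq> carrier (free_group {..<n})"
    and \<rho>: "\<rho> \<in> epi (free_group {..<n}) H"
    and ker: "kernel (free_group {..<n}) H \<rho> = normal_closure (free_group {..<n}) R"
    by (rule finitely_presented_epi[OF H fp])
  define F where "F = free_group {..<n}"
  interpret F: group F unfolding F_def by (rule group_free_group)
  interpret G: group G by (rule G)
  interpret H: group H by (rule H)
  interpret \<rho>: group_hom F H \<rho>
    using \<rho> by (simp add: group_hom_def group_hom_axioms_def epi_def F_def F.is_group[unfolded F_def] H)
  interpret \<eta>: group_hom H G \<eta>
    using \<eta> by (simp add: group_hom_def group_hom_axioms_def epi_def G H)
  define \<eta>' where "\<eta>' w = \<eta> (\<rho> w)" for w
  have \<eta>'_hom: "\<eta>' \<in> hom F G"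
    by (auto intro!: homI simp: \<eta>'_def)
  interpret \<eta>': group_hom F G \<eta>'
    using \<eta>'_hom by (simp add: group_hom_def group_hom_axioms_def G F.is_group)
  define a where "a x = \<eta>' [(x, True)]" for x
  have a: "a \<in> {..<n} \<rightarrow> carrier G"
    by (auto simp: a_def F_def singleton_in_free_group intro!: \<eta>'.hom_closed)
  have val: "\<eta>' w = word_val G a w" if "w \<in> carrier F" for w
    using hom_free_group_eq_word_val[OF G \<eta>'_hom[unfolded F_def], of w] that
    by (simp add: F_def a_def[abs_def])
  have "\<exists>w\<in>carrier F. \<eta>' w = c" if "c \<in> C" for c
  proof -
    have "c \<in> \<eta> ` \<rho> ` carrier F"
      using that C(2) \<rho> \<eta> by (auto simp: epi_def F_def)
    then show ?thesis
      by (auto simp: \<eta>'_def)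
  qed
  then obtain u where u: "\<And>c. c \<in> C \<Longrightarrow> u c \<in> carrier F" "\<And>c. c \<in> C \<Longrightarrow> \<eta>' (u c) = c"
    by metis
  define \<Omega> where "\<Omega> = R \<union> u ` C"
  have \<Omega>: "finite \<Omega>" "\<Omega> \<subseteq> carrier F"
    using R C u by (auto simp: \<Omega>_def F_def)
  \<comment> \<open>\<open>word_val\<close> multiplies from the right, so the intermediate values of
    a word are the values of its suffixes.\<close>
  define suff where "suff w = (\<lambda>k. drop k w) ` {..length w}" for w :: "nat letter list"
  have suff: "v \<in> suff w \<longleftrightarrow> (\<exists>x. w = x @ v)" for v w
  proof
    assume "\<exists>x. w = x @ v"
    then obtain x where "w = x @ v" by blast
    then have "v = drop (length x) w" "length x \<le> length w" by auto
    then show "v \<in> suff w" unfolding suff_def by blast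
  next
    assume "v \<in> suff w"
    then show "\<exists>x. w = x @ v"
      unfolding suff_def by (metis append_take_drop_id imageE)
  qed
  \<comment> \<open>The pair of identities forces \<open>\<Psi>\<close> to fix the identity, and the
    pairs of inverses force it to respect inverses of generators. \<open>E\<close> is built before
    \<open>W\<close> and \<open>\<Psi>\<close> enter, so the target may later be designed around
    it.\<close>
  define E where "E = insert (\<one>\<^bsub>G\<^esub>, \<one>\<^bsub>G\<^esub>) ((\<lambda>x. (inv\<^bsub>G\<^esub> a x, a x)) ` {..<n} \<union>
    (\<lambda>v. (letter_val G a (hd v), word_val G a (tl v))) ` ((\<Union>w\<in>\<Omega>. suff w) - {[]}))"
  have in_F: "fst ` set v \<subseteq> {..<n}" if wv: "w \<in> \<Omega>" "v \<in> suff w" for v w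
  proof -
    have "fst ` set w \<subseteq> {..<n}"
      using that(1) \<Omega>(2) by (auto simp: F_def carrier_free_group)
    moreover obtain x where "w = x @ v"
      using wv(2) suff by blast
    ultimately show ?thesis
      by (simp add: image_Un)
  qed
  have "finite E"
    using \<Omega>(1) by (simp add: E_def suff_def)
  moreover have "E \<subseteq> carrier G \<times> carrier G"
  proof -
    have "letter_val G a (hd v) \<in> carrier G \<and> word_val G a (tl v) \<in> carrier G"
      if "w \<in> \<Omega>" "v \<in> suff w" "v \<noteq> []" for v w
      using in_F[OF that(1,2)] that(3) a by (cases v) (auto intro!: G.letter_val_closed G.word_val_closed)
    then show ?thesis
      using a by (auto simp: E_def)
  qed
  moreover have "\<exists>\<theta>\<in>hom H W. \<forall>c\<in>C. \<exists>h\<in>carrier H. \<eta> h = c \<and> \<theta> h = \<Psi> c"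
    if W: "group W" and \<Psi>: "\<Psi> \<in> carrier G \<rightarrow> carrier W"
      and pairs: "\<forall>(x, y)\<in>E. \<Psi> (x \<otimes>\<^bsub>G\<^esub> y) = \<Psi> x \<otimes>\<^bsub>W\<^esub> \<Psi> y"
    for W :: "('w, 'k) monoid_scheme" and \<Psi>
  proof -
    interpret W: group W by (rule W)
    have mult: "\<Psi> (x \<otimes>\<^bsub>G\<^esub> y) = \<Psi> x \<otimes>\<^bsub>W\<^esub> \<Psi> y" if "(x, y) \<in> E" for x y
      using pairs that by blast
    have \<Psi>c [simp]: "\<Psi> x \<in> carrier W" if "x \<in> carrier G" for x
      using that \<Psi> by blast
    have \<Psi>1: "\<Psi> \<one>\<^bsub>G\<^esub> = \<one>\<^bsub>W\<^esub>"
    proof -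
      have "(\<one>\<^bsub>G\<^esub>, \<one>\<^bsub>G\<^esub>) \<in> E" by (simp add: E_def)
      then have "\<Psi> \<one>\<^bsub>G\<^esub> \<otimes>\<^bsub>W\<^esub> \<Psi> \<one>\<^bsub>G\<^esub> = \<Psi> \<one>\<^bsub>G\<^esub>"
        using mult[of "\<one>\<^bsub>G\<^esub>" "\<one>\<^bsub>G\<^esub>"] by simp
      then show ?thesis
        using W.l_cancel_one[of "\<Psi> \<one>\<^bsub>G\<^esub>" "\<Psi> \<one>\<^bsub>G\<^esub>"] by simp
    qed
    have \<Psi>a: "(\<lambda>x. \<Psi> (a x)) \<in> {..<n} \<rightarrow> carrier W"
      using a by (auto simp: Pi_iff)
    have letter: "\<Psi> (letter_val G a l) = letter_val W (\<lambda>x. \<Psi> (a x)) l" if "fst l \<in> {..<n}" for l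
    proof (cases l)
      case (Pair x e)
      have ax: "a x \<in> carrier G" using a that Pair by auto
      have "\<Psi> (inv\<^bsub>G\<^esub> a x) \<otimes>\<^bsub>W\<^esub> \<Psi> (a x) = \<one>\<^bsub>W\<^esub>"
        using mult[of "inv\<^bsub>G\<^esub> a x" "a x"] ax \<Psi>1 that Pair by (simp add: E_def)
      then have "inv\<^bsub>W\<^esub> \<Psi> (a x) = \<Psi> (inv\<^bsub>G\<^esub> a x)"
        using ax by (intro W.inv_equality) auto
      then show ?thesis
        using Pair by simp
    qed
    \<comment> \<open>\<open>\<Psi>\<close> need not be a homomorphism, but on these suffixes it
      agrees with genuine word evaluation in \<open>W\<close>: each added letter is a product
      recorded in \<open>E\<close>.\<close>
    have word: "\<Psi> (word_val G a v) = word_val W (\<lambda>x. \<Psi> (a x)) v" if "w \<in> \<Omega>" "v \<in> suff w" for v w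
      using that(2)
    proof (induction v)
      case Nil
      then show ?case using \<Psi>1 by simp
    next
      case (Cons l v)
      have "v \<in> suff w"
        using Cons.prems suff by (metis append.assoc append_Cons append_Nil)
      moreover have "(letter_val G a l, word_val G a v) \<in> E"
      proof -
        have "l # v \<in> (\<Union>w\<in>\<Omega>. suff w) - {[]}"
          using Cons.prems that(1) by blast
        then show ?thesis
          unfolding E_def by (metis (no_types, lifting) UnI2 image_eqI insertI2 list.sel(1,3))
      qed
      moreover have "fst l \<in> {..<n}"
        using in_F[OF that(1) Cons.prems] by simp
      ultimately show ?case
        using Cons.IH mult letter by simp
    qed
    define f where "f = word_val W (\<lambda>x. \<Psi> (a x))"
    have f: "f \<in> hom F W"
      unfolding f_def F_def using \<Psi>a by (rule W.word_val_hom)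
    interpret f: group_hom F W f
      using f by (simp add: group_hom_def group_hom_axioms_def W F.is_group)
    have f\<Omega>: "f w = \<Psi> (\<eta>' w)" if "w \<in> \<Omega>" for w
      using word[OF that, of w] val[of w] that \<Omega>(2) by (auto simp: f_def suff)
    have "R \<subseteq> kernel F W f"
    proof
      fix r assume r: "r \<in> R"
      then have rF: "r \<in> carrier F" using R by (auto simp: F_def)
      have "\<one>\<^bsub>F\<^esub> \<otimes>\<^bsub>F\<^esub> r \<otimes>\<^bsub>F\<^esub> inv\<^bsub>F\<^esub> \<one>\<^bsub>F\<^esub> \<in> normal_closure F R"
        unfolding normal_closure_def using r by (intro generate.incl) blast
      then have "r \<in> normal_closure F R"
        using rF by simp
      then have "r \<in> kernel F H \<rho>"
        using ker by (simp add: F_def)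
      then have "\<eta>' r = \<one>\<^bsub>G\<^esub>"
        by (simp add: \<eta>'_def kernel_def)
      then show "r \<in> kernel F W f"
        using f\<Omega>[of r] r rF \<Psi>1 by (simp add: \<Omega>_def kernel_def)
    qed
    then have "kernel F H \<rho> \<subseteq> kernel F W f"
      using f.normal_closure_subset_kernel ker by (simp add: F_def)
    then obtain \<theta> where \<theta>: "\<theta> \<in> hom H W" "\<And>w. w \<in> carrier F \<Longrightarrow> \<theta> (\<rho> w) = f w"
      using hom_factor_through_epi[OF F.is_group H W \<rho>[folded F_def] f] by blast
    have "\<exists>h\<in>carrier H. \<eta> h = c \<and> \<theta> h = \<Psi> c" if "c \<in> C" for c
      using \<theta>(2)[OF u(1)[OF that]] u[OF that] f\<Omega>[of "u c"] that
      by (intro bexI[of _ "\<rho> (u c)"]) (auto simp: \<Omega>_def \<eta>'_def)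
    then show ?thesis
      using \<theta>(1) by blast
  qed
  ultimately show thesis
    using that by blast
qed

section \<open>Finite index subgroups\<close>

text \<open>The value of \<open>F\<close> at any one element of a right coset determines that coset,
  so there are at most as many cosets as elements of \<open>T\<close>.\<close>

lemma (in group) finite_index_if_finite_invariant:
  assumes "subgroup K G" "finite T" and F: "F \<in> carrier G \<rightarrow> T"
    and eq: "\<And>x y. \<lbrakk>x \<in> carrier G; y \<in> carrier G; F x = F y\<rbrakk> \<Longrightarrow> x \<otimes> inv y \<in> K"
  shows "finite_index K G"
proof -
  interpret K: subgroup K G by fact
  define r where "r t = (SOME x. x \<in> carrier G \<and> F x = t)" for t
  have "K #> x = K #> r (F x)" if x: "x \<in> carrier G" for x
  proof -
    have r: "r (F x) \<in> carrier G \<and> F (r (F x)) = F x"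
      unfolding r_def by (rule someI[of _ x]) (use x in simp)
    then have "x \<otimes> inv (r (F x)) \<in> K"
      using eq x by auto
    then have "x \<in> K #> r (F x)"
      using K.rcos_module_rev[OF is_group] r x by simp
    then show ?thesis
      using repr_independence[OF _ _ K.subgroup_axioms] r by simp
  qed
  then have "rcosets K \<subseteq> (\<lambda>t. K #> r t) ` T"
    using F by (auto simp: RCOSETS_def)
  then show ?thesis
    unfolding finite_index_def using assms(1,2) finite_surj by blast
qed

section \<open>Separating finite sets in finite quotients\<close>

text \<open>Excluded elements are handled one at a time by intersecting normal subgroups; the pair
  of cosets of an element is a finite invariant showing that the intersection keeps finite
  index.\<close>

lemma (in group) residually_finite_avoid:
  assumes rf: "residually_finite G" and Z: "finite Z" "Z \<subseteq> carrier G - {\<one>}"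
  obtains N where "N \<lhd> G" "finite_index N G" "N \<inter> Z = {}"
proof -
  from Z have "\<exists>N. N \<lhd> G \<and> finite_index N G \<and> N \<inter> Z = {}"
  proof (induction Z)
    case empty
    have "finite_index (carrier G) G"
      by (rule finite_index_if_finite_invariant[of "carrier G" "{()}"]) (auto simp: subgroup_self)
    moreover have "carrier G \<lhd> G"
      by (simp add: normal_inv_iff subgroup_self)
    ultimately show ?case by blast
  next
    case (insert z Z)
    then obtain N where N: "N \<lhd> G" "finite_index N G" "N \<inter> Z = {}"
      by auto
    obtain M where M: "M \<lhd> G" "finite_index M G" "z \<notin> M"
      using insert.prems rf by (auto simp: residually_finite_def)
    interpret N: normal N G by fact
    interpret M: normal M G by fact
    have NM: "N \<inter> M \<lhd> G"
      using N M by (simp add: normal_subgroup_intersect)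
    have "finite_index (N \<inter> M) G"
    proof (rule finite_index_if_finite_invariant)
      show "finite ((rcosets N) \<times> (rcosets M))"
        using N M by (simp add: finite_index_def)
      show "(\<lambda>x. (N #> x, M #> x)) \<in> carrier G \<rightarrow> (rcosets N) \<times> (rcosets M)"
        by (auto simp: RCOSETS_def)
      fix x y assume xy: "x \<in> carrier G" "y \<in> carrier G" "(N #> x, M #> x) = (N #> y, M #> y)"
      then have "x \<in> N #> y" "x \<in> M #> y"
        using rcos_self[OF xy(1) N.subgroup_axioms] rcos_self[OF xy(1) M.subgroup_axioms] by auto
      then show "x \<otimes> inv y \<in> N \<inter> M"
        using xy N.rcos_module_imp[OF is_group] M.rcos_module_imp[OF is_group] by auto
    qed (use NM normal_imp_subgroup in auto)
    then show ?case
      using N(3) M(3) NM by blast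
  qed
  then show thesis
    using that by blast
qed

text \<open>Infinitude supplies three elements whose mutual quotients avoid the finite set
  \<open>D\<close> of quotients from \<open>S\<close>. A coincidence modulo \<open>N\<close> puts
  \<open>inv (b i) \<otimes> b j \<otimes> (inv t \<otimes> s)\<close> into \<open>N\<close>; since
  \<open>N\<close> excludes the finitely many non-trivial products of this form, the coincidence
  already holds in \<open>G\<close>.\<close>

lemma (in group) residually_finite_translates:
  assumes inf: "infinite (carrier G)" and rf: "residually_finite G"
    and S: "finite S" "S \<subseteq> carrier G"
  obtains N and b :: "nat \<Rightarrow> 'a" where "N \<lhd> G" "finite_index N G" "\<forall>i. b i \<in> carrier G"
    "\<forall>i<3. \<forall>j<3. \<forall>s\<in>S. \<forall>t\<in>S. \<forall>p\<in>carrier (G Mod N). N #> s = p \<otimes>\<^bsub>G Mod N\<^esub> (N #> b i) \<longrightarrow>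
        N #> t = p \<otimes>\<^bsub>G Mod N\<^esub> (N #> b j) \<longrightarrow> i = j \<and> s = t"
proof -
  define D where "D = (\<lambda>(s, t). inv s \<otimes> t) ` (S \<times> S)"
  have D: "finite D" "D \<subseteq> carrier G" using S by (auto simp: D_def)
  have D_inv: "inv d \<in> D" if "d \<in> D" for d
    using that S(2) by (force simp: D_def inv_mult_group subset_iff)
  obtain b1 where b1: "b1 \<in> carrier G" "b1 \<notin> D"
    using inf D(1) by (meson finite_subset subsetI)
  \<comment> \<open>Avoiding \<open>D\<close> separates \<open>b2\<close> from the identity, which
    serves as \<open>b 0\<close>; avoiding \<open>b1 D\<close> separates it from
    \<open>b1\<close>.\<close>
  obtain b2 where b2: "b2 \<in> carrier G" "b2 \<notin> D \<union> (\<otimes>) b1 ` D"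
    using inf D(1) by (meson finite_subset finite_UnI finite_imageI subsetI)
  define b where "b i = (if i = 0 then \<one> else if i = 1 then b1 else b2)" for i :: nat
  have b: "b i \<in> carrier G" for i
    using b1 b2 by (simp add: b_def)
  have lt: "inv (b i) \<otimes> b j \<notin> D" if "i < j" "j < 3" for i j
  proof -
    have "inv b1 \<otimes> b2 \<notin> D"
    proof
      assume "inv b1 \<otimes> b2 \<in> D"
      moreover have "b2 = b1 \<otimes> (inv b1 \<otimes> b2)" using b1 b2 by (simp add: m_assoc[symmetric])
      ultimately show False using b2 by blast
    qed
    moreover have "i = 0 \<and> j = 1 \<or> i = 0 \<and> j = 2 \<or> i = 1 \<and> j = 2"
      using that by linarith
    ultimately show ?thesis
      using b1 b2 by (auto simp: b_def)
  qed
  have sep: "i = j" if "inv (b i) \<otimes> b j \<in> D" "i < 3" "j < 3" for i j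
  proof (rule ccontr)
    assume "i \<noteq> j"
    moreover have "inv (b j) \<otimes> b i \<in> D"
      using D_inv[OF that(1)] b by (simp add: inv_mult_group)
    ultimately show False
      using lt[of i j] lt[of j i] that by (cases "i < j") auto
  qed
  define Z where "Z = (\<lambda>(i, j, s, t). inv (b i) \<otimes> b j \<otimes> (inv t \<otimes> s)) ` ({..<3} \<times> {..<3} \<times> S \<times> S) - {\<one>}"
  have "finite Z" "Z \<subseteq> carrier G - {\<one>}"
    using S b by (auto simp: Z_def subset_iff)
  then obtain N where N: "N \<lhd> G" "finite_index N G" "N \<inter> Z = {}"
    by (rule residually_finite_avoid[OF rf])
  interpret N: normal N G by (rule N)
  interpret P: group "G Mod N" by (rule N.factorgroup_is_group)
  interpret \<beta>: group_hom G "G Mod N" "\<lambda>x. N #> x"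
    by (simp add: group_hom_def group_hom_axioms_def is_group P.is_group N.r_coset_hom_Mod)
  have main: "i = j \<and> s = t" if ij: "i < 3" "j < 3" and st: "s \<in> S" "t \<in> S" and p: "p \<in> carrier (G Mod N)"
    and eq: "N #> s = p \<otimes>\<^bsub>G Mod N\<^esub> (N #> b i)" "N #> t = p \<otimes>\<^bsub>G Mod N\<^esub> (N #> b j)" for i j s t p
  proof -
    have stG: "s \<in> carrier G" "t \<in> carrier G" using st S by auto
    note cl = stG b p
    let ?\<beta> = "\<lambda>x. N #> x"
    have cl': "?\<beta> s \<in> carrier (G Mod N)" "?\<beta> t \<in> carrier (G Mod N)"
      "?\<beta> (b i) \<in> carrier (G Mod N)" "?\<beta> (b j) \<in> carrier (G Mod N)"
      by (rule \<beta>.hom_closed, rule cl)+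
    have hom: "?\<beta> (x \<otimes> y) = ?\<beta> x \<otimes>\<^bsub>G Mod N\<^esub> ?\<beta> y" "?\<beta> (inv x) = inv\<^bsub>G Mod N\<^esub> ?\<beta> x"
      if "x \<in> carrier G" "y \<in> carrier G" for x y
      using that \<beta>.hom_mult \<beta>.hom_inv by auto
    define z where "z = inv (b i) \<otimes> b j \<otimes> (inv t \<otimes> s)"
    have "?\<beta> z = inv\<^bsub>G Mod N\<^esub> ?\<beta> (b i) \<otimes>\<^bsub>G Mod N\<^esub> ?\<beta> (b j) \<otimes>\<^bsub>G Mod N\<^esub> (inv\<^bsub>G Mod N\<^esub> ?\<beta> t \<otimes>\<^bsub>G Mod N\<^esub> ?\<beta> s)"
      unfolding z_def using cl by (simp only: hom m_closed inv_closed)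
    also have "\<dots> = \<one>\<^bsub>G Mod N\<^esub>"
      unfolding eq using cl' p
      by (simp only: P.inv_mult_group P.m_assoc P.m_closed P.inv_closed P.inv_solve_left P.l_inv P.r_one)
        (metis P.inv_closed P.l_inv P.m_assoc P.m_closed P.r_inv P.l_one)
    finally have "z \<in> N"
      using coset_join1[OF _ _ N.subgroup_axioms, of z] cl by (simp add: z_def N.subset)
    moreover have "z \<in> insert \<one> Z"
    proof -
      have "z \<in> (\<lambda>(i, j, s, t). inv (b i) \<otimes> b j \<otimes> (inv t \<otimes> s)) ` ({..<3} \<times> {..<3} \<times> S \<times> S)"
        unfolding z_def using ij st by (intro image_eqI[of _ _ "(i, j, s, t)"]) auto
      then show ?thesis
        unfolding Z_def by blast
    qed
    ultimately have "z = \<one>"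
      using N(3) by blast
    \<comment> \<open>The right-hand side lies in \<open>D\<close>, so \<open>sep\<close> forces
      equal indices, and then the left-hand side is the identity.\<close>
    then have "inv (b i) \<otimes> b j = inv s \<otimes> t"
      using cl inv_equality[of "inv (b i) \<otimes> b j" "inv t \<otimes> s"] by (simp add: z_def inv_mult_group)
    moreover from this have "i = j"
      using sep ij st by (force simp: D_def)
    ultimately have "i = j" "inv s \<otimes> t = \<one>"
      using cl by auto
    then show ?thesis
      using stG by (metis inv_equality inv_inv inv_closed)
  qed
  show thesis
  proof (rule that[OF N(1,2)])
    show "\<forall>i. b i \<in> carrier G"
      using b by simp
    show "\<forall>i<3. \<forall>j<3. \<forall>s\<in>S. \<forall>t\<in>S. \<forall>p\<in>carrier (G Mod N). N #> s = p \<otimes>\<^bsub>G Mod N\<^esub> (N #> b i) \<longrightarrow>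
        N #> t = p \<otimes>\<^bsub>G Mod N\<^esub> (N #> b j) \<longrightarrow> i = j \<and> s = t"
      by (intro allI ballI impI) (rule main)
  qed
qed

section \<open>The permutational wreath product\<close>

text \<open>A pair \<open>(p, c)\<close> stands for the permutation \<open>(t, x) \<mapsto> (p t, c t \<otimes> x)\<close> of \<open>T \<times> carrier \<Phi>\<close>.\<close>

definition perm_wreath :: "('g, 'm) monoid_scheme \<Rightarrow> 't set \<Rightarrow> (('t \<Rightarrow> 't) \<times> ('t \<Rightarrow> 'g)) monoid"
  where "perm_wreath \<Phi> T =
    \<lparr>carrier = Bij T \<times> (T \<rightarrow>\<^sub>E carrier \<Phi>),
     monoid.mult = (\<lambda>(p, c) (q, d). (compose T p q, \<lambda>t\<in>T. c (q t) \<otimes>\<^bsub>\<Phi>\<^esub> d t)),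
     one = (\<lambda>t\<in>T. t, \<lambda>t\<in>T. \<one>\<^bsub>\<Phi>\<^esub>)\<rparr>"

lemma group_perm_wreath:
  assumes "group \<Phi>"
  shows "group (perm_wreath \<Phi> T)"
proof -
  interpret \<Phi>: group \<Phi> by fact
  have BijD: "p t \<in> T" if "p \<in> Bij T" "t \<in> T" for p t
    using that Bij_imp_funcset by blast
  have cl: "c t \<in> carrier \<Phi>" if "c \<in> T \<rightarrow>\<^sub>E carrier \<Phi>" "t \<in> T" for c t
    using that by auto
  show ?thesis
  proof (rule groupI)
    fix x assume x: "x \<in> carrier (perm_wreath \<Phi> T)"
    obtain p c where pc: "x = (p, c)" "p \<in> Bij T" "c \<in> T \<rightarrow>\<^sub>E carrier \<Phi>"
      using x by (cases x) (auto simp: perm_wreath_def)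
    define p' where "p' = restrict (inv_into T p) T"
    \<comment> \<open>The inverse must undo the label of the point from which \<open>t\<close> was
      reached, hence \<open>c\<close> is read at \<open>p' t\<close> rather than at
      \<open>t\<close>.\<close>
    define y where "y = (p', \<lambda>t\<in>T. inv\<^bsub>\<Phi>\<^esub> c (p' t))"
    have p': "p' \<in> Bij T" unfolding p'_def using pc(2) by (rule restrict_inv_into_Bij)
    have 1: "compose T p' p = (\<lambda>t\<in>T. t)"
      unfolding p'_def using pc(2) by (rule Bij_compose_restrict_eq)
    have 2: "p' (p t) = t" if "t \<in> T" for t
      using fun_cong[OF 1, of t] that by (simp add: compose_def)
    have "y \<in> carrier (perm_wreath \<Phi> T)"
      using p' pc by (auto simp: y_def perm_wreath_def BijD cl)
    moreover have "y \<otimes>\<^bsub>perm_wreath \<Phi> T\<^esub> x = \<one>\<^bsub>perm_wreath \<Phi> T\<^esub>"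
      using 1 2 pc by (auto simp: y_def perm_wreath_def BijD cl fun_eq_iff)
    ultimately show "\<exists>y\<in>carrier (perm_wreath \<Phi> T). y \<otimes>\<^bsub>perm_wreath \<Phi> T\<^esub> x = \<one>\<^bsub>perm_wreath \<Phi> T\<^esub>"
      by blast
  next
    show "x \<otimes>\<^bsub>perm_wreath \<Phi> T\<^esub> y \<otimes>\<^bsub>perm_wreath \<Phi> T\<^esub> z = x \<otimes>\<^bsub>perm_wreath \<Phi> T\<^esub> (y \<otimes>\<^bsub>perm_wreath \<Phi> T\<^esub> z)"
      if "x \<in> carrier (perm_wreath \<Phi> T)" "y \<in> carrier (perm_wreath \<Phi> T)" "z \<in> carrier (perm_wreath \<Phi> T)"
      for x y z
      using that by (auto simp: perm_wreath_def compose_def BijD cl \<Phi>.m_assoc fun_eq_iff)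
    show "\<one>\<^bsub>perm_wreath \<Phi> T\<^esub> \<otimes>\<^bsub>perm_wreath \<Phi> T\<^esub> x = x" if "x \<in> carrier (perm_wreath \<Phi> T)" for x
    proof (cases x)
      case (Pair p c)
      then have p: "p \<in> Bij T" and c: "c \<in> T \<rightarrow>\<^sub>E carrier \<Phi>"
        using that by (auto simp: perm_wreath_def)
      have "(\<lambda>t\<in>T. (\<lambda>t\<in>T. \<one>\<^bsub>\<Phi>\<^esub>) (p t) \<otimes>\<^bsub>\<Phi>\<^esub> c t) = c"
        using c BijD[OF p] by (auto simp: fun_eq_iff PiE_iff extensional_def)
      moreover have "compose T (\<lambda>t\<in>T. t) p = p"
        using p by (simp add: Id_compose Bij_imp_funcset Bij_imp_extensional)
      ultimately show ?thesis
        using Pair by (simp add: perm_wreath_def)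
    qed
  qed (auto simp: perm_wreath_def id_Bij compose_Bij BijD cl)
qed

lemma perm_wreath_apply:
  assumes "x \<in> carrier (perm_wreath \<Phi> T)" "y \<in> carrier (perm_wreath \<Phi> T)" "t \<in> T"
  shows "fst (x \<otimes>\<^bsub>perm_wreath \<Phi> T\<^esub> y) t = fst x (fst y t)"
    and "snd (x \<otimes>\<^bsub>perm_wreath \<Phi> T\<^esub> y) t = snd x (fst y t) \<otimes>\<^bsub>\<Phi>\<^esub> snd y t"
  using assms by (auto simp: perm_wreath_def compose_def case_prod_beta)

text \<open>Two elements moving \<open>t\<close> to the same point yield an element of the
  stabiliser of \<open>t\<close> whose label is the quotient of their labels. This is how prescribed
  elements of \<open>\<Phi>\<close> are produced.\<close>

lemma perm_wreath_inv_apply: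
  assumes \<Phi>: "group \<Phi>" and u: "u \<in> carrier (perm_wreath \<Phi> T)" and v: "v \<in> carrier (perm_wreath \<Phi> T)"
    and t: "t \<in> T" and eq: "fst u t = fst v t"
  shows "fst (inv\<^bsub>perm_wreath \<Phi> T\<^esub> u \<otimes>\<^bsub>perm_wreath \<Phi> T\<^esub> v) t = t"
    and "snd (inv\<^bsub>perm_wreath \<Phi> T\<^esub> u \<otimes>\<^bsub>perm_wreath \<Phi> T\<^esub> v) t = inv\<^bsub>\<Phi>\<^esub> (snd u t) \<otimes>\<^bsub>\<Phi>\<^esub> snd v t"
proof -
  interpret \<Phi>: group \<Phi> by (rule \<Phi>)
  interpret W: group "perm_wreath \<Phi> T" by (rule group_perm_wreath[OF \<Phi>])
  define u' where "u' = inv\<^bsub>perm_wreath \<Phi> T\<^esub> u"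
  have u': "u' \<in> carrier (perm_wreath \<Phi> T)" using u by (simp add: u'_def)
  have one: "u' \<otimes>\<^bsub>perm_wreath \<Phi> T\<^esub> u = \<one>\<^bsub>perm_wreath \<Phi> T\<^esub>" using u by (simp add: u'_def)
  have "fst u' (fst u t) = t"
    using perm_wreath_apply(1)[OF u' u t] t one by (simp add: perm_wreath_def)
  then show "fst (u' \<otimes>\<^bsub>perm_wreath \<Phi> T\<^esub> v) t = t"
    using perm_wreath_apply(1)[OF u' v t] eq by simp
  have fut: "fst u t \<in> T"
    using u t Bij_imp_funcset by (fastforce simp: perm_wreath_def)
  have cl: "snd u' (fst u t) \<in> carrier \<Phi>" "snd u t \<in> carrier \<Phi>"
    using u u' t fut by (auto simp: perm_wreath_def)
  have "snd u' (fst u t) \<otimes>\<^bsub>\<Phi>\<^esub> snd u t = \<one>\<^bsub>\<Phi>\<^esub>"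
    using perm_wreath_apply(2)[OF u' u t] t one by (simp add: perm_wreath_def)
  then have "snd u' (fst u t) = inv\<^bsub>\<Phi>\<^esub> (snd u t)"
    using cl \<Phi>.inv_equality by metis
  then show "snd (u' \<otimes>\<^bsub>perm_wreath \<Phi> T\<^esub> v) t = inv\<^bsub>\<Phi>\<^esub> (snd u t) \<otimes>\<^bsub>\<Phi>\<^esub> snd v t"
    using perm_wreath_apply(2)[OF u' v t] eq by simp
qed

text \<open>The orbit of a point of a finite set is finite, so its stabiliser has finite index. At a
  fixed point the twist in the product formula for labels disappears, leaving a
  homomorphism.\<close>

lemma perm_wreath_stabilizer:
  assumes "group H" "group \<Phi>" and \<theta>: "\<theta> \<in> hom H (perm_wreath \<Phi> T)" and T: "finite T" "t\<^sub>0 \<in> T"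
  defines "K \<equiv> {h \<in> carrier H. fst (\<theta> h) t\<^sub>0 = t\<^sub>0}"
  shows "finite_index K H" and "(\<lambda>h. snd (\<theta> h) t\<^sub>0) \<in> hom (H\<lparr>carrier := K\<rparr>) \<Phi>"
proof -
  interpret H: group H by fact
  interpret \<Phi>: group \<Phi> by fact
  interpret W: group "perm_wreath \<Phi> T" by (rule group_perm_wreath) fact
  interpret \<theta>: group_hom H "perm_wreath \<Phi> T" \<theta>
    using \<theta> by (simp add: group_hom_def group_hom_axioms_def)
  have cl: "fst (\<theta> h) \<in> Bij T" "snd (\<theta> h) \<in> T \<rightarrow>\<^sub>E carrier \<Phi>" if "h \<in> carrier H" for h
    using \<theta>.hom_closed[OF that] by (auto simp: perm_wreath_def)
  have mult: "fst (\<theta> (g \<otimes>\<^bsub>H\<^esub> h)) t = fst (\<theta> g) (fst (\<theta> h) t)"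
      "snd (\<theta> (g \<otimes>\<^bsub>H\<^esub> h)) t = snd (\<theta> g) (fst (\<theta> h) t) \<otimes>\<^bsub>\<Phi>\<^esub> snd (\<theta> h) t"
    if "g \<in> carrier H" "h \<in> carrier H" "t \<in> T" for g h t
    using that by (auto simp: perm_wreath_def compose_def case_prod_beta)
  have one: "fst (\<theta> \<one>\<^bsub>H\<^esub>) t = t" if "t \<in> T" for t
    using that \<theta>.hom_one by (simp add: perm_wreath_def)
  have inv: "fst (\<theta> (inv\<^bsub>H\<^esub> h)) (fst (\<theta> h) t) = t" if "h \<in> carrier H" "t \<in> T" for h t
    using mult(1)[of "inv\<^bsub>H\<^esub> h" h t] one that by simp
  have K: "subgroup K H"
  proof (rule H.subgroupI)
    show "K \<noteq> {}" using one T by (auto simp: K_def)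
    show "inv\<^bsub>H\<^esub> h \<in> K" if "h \<in> K" for h
      using that inv[of h t\<^sub>0] T by (simp add: K_def)
    show "g \<otimes>\<^bsub>H\<^esub> h \<in> K" if "g \<in> K" "h \<in> K" for g h
      using that mult T by (simp add: K_def)
  qed (auto simp: K_def)
  show "finite_index K H"
  proof (rule H.finite_index_if_finite_invariant[OF K T(1)])
    \<comment> \<open>Inverses appear because right cosets are counted: \<open>x\<close> times the
      inverse of \<open>y\<close> fixes the base point exactly when the two inverses move it to the
      same place.\<close>
    show "(\<lambda>h. fst (\<theta> (inv\<^bsub>H\<^esub> h)) t\<^sub>0) \<in> carrier H \<rightarrow> T"
      using Bij_imp_funcset[OF cl(1)] T(2) by auto
    show "x \<otimes>\<^bsub>H\<^esub> inv\<^bsub>H\<^esub> y \<in> K" if "x \<in> carrier H" "y \<in> carrier H"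
      and "fst (\<theta> (inv\<^bsub>H\<^esub> x)) t\<^sub>0 = fst (\<theta> (inv\<^bsub>H\<^esub> y)) t\<^sub>0" for x y
      using that mult(1)[of x "inv\<^bsub>H\<^esub> y" t\<^sub>0] inv[of "inv\<^bsub>H\<^esub> x" t\<^sub>0] T by (simp add: K_def)
  qed
  show "(\<lambda>h. snd (\<theta> h) t\<^sub>0) \<in> hom (H\<lparr>carrier := K\<rparr>) \<Phi>"
    using mult T PiE_mem[OF cl(2)] by (intro homI) (auto simp: K_def simp del: \<theta>.hom_mult)
qed

section \<open>Finite approximations of the wreath product\<close>

definition delta :: "('a, 'k) monoid_scheme \<Rightarrow> ('b, 'l) monoid_scheme \<Rightarrow> 'a \<Rightarrow> 'b \<Rightarrow> 'a"
  where "delta A B a = (\<lambda>x\<in>carrier B. if x = \<one>\<^bsub>B\<^esub> then a else \<one>\<^bsub>A\<^esub>)"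

lemma delta_closed:
  assumes "group A" "a \<in> carrier A"
  shows "delta A B a \<in> carrier (sum_group (carrier B) (\<lambda>_. A))"
proof -
  interpret A: group A by fact
  have "{x \<in> carrier B. delta A B a x \<noteq> \<one>\<^bsub>A\<^esub>} \<subseteq> {\<one>\<^bsub>B\<^esub>}"
    by (auto simp: delta_def split: if_splits)
  then have "finite {x \<in> carrier B. delta A B a x \<noteq> \<one>\<^bsub>A\<^esub>}"
    using finite_subset by blast
  then show ?thesis
    using assms by (auto simp: carrier_sum_group delta_def)
qed

text \<open>By \<open>separated\<close>, at most one pair of an index and a coordinate governs each
  fibre over \<open>P\<close>. The gauges \<open>y\<close> take values in \<open>\<Phi>\<close> for
  every index, because \<open>idx\<close> is arbitrary over fibres that no coordinate
  governs.\<close>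

locale wreath_approx =
  A: group A + B: group B + Q: group Q + P: group P + \<Phi>: group \<Phi> +
  \<alpha>: group_hom A Q \<alpha> + \<beta>: group_hom B P \<beta>
  for A :: "('a, 'k) monoid_scheme" and B :: "('b, 'l) monoid_scheme" and Q :: "('q, 'm) monoid_scheme"
    and P :: "('p, 'n) monoid_scheme" and \<Phi> :: "('g, 'o) monoid_scheme" and \<alpha> \<beta> +
  fixes S :: "'b set" and I :: "'i set" and b :: "'i \<Rightarrow> 'b" and y :: "'i \<Rightarrow> 'q \<Rightarrow> 'g"
  assumes S: "S \<subseteq> carrier B" and b: "i \<in> I \<Longrightarrow> b i \<in> carrier B"
    and y: "r \<in> carrier Q \<Longrightarrow> y i r \<in> carrier \<Phi>"
    and separated: "\<lbrakk>i \<in> I; j \<in> I; s \<in> S; t \<in> S; p \<in> carrier P;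
        \<beta> s = p \<otimes>\<^bsub>P\<^esub> \<beta> (b i); \<beta> t = p \<otimes>\<^bsub>P\<^esub> \<beta> (b j)\<rbrakk> \<Longrightarrow> i = j \<and> s = t"
begin

abbreviation "N \<equiv> sum_group (carrier B) (\<lambda>_. A)"
abbreviation "T \<equiv> carrier P \<times> carrier Q"
abbreviation "W \<equiv> perm_wreath \<Phi> T"

section \<open>The coordinate acting in a given fibre\<close>

definition sel :: "'p \<Rightarrow> 'i \<times> 'b \<Rightarrow> bool"
  where "sel p = (\<lambda>(i, s). i \<in> I \<and> s \<in> S \<and> \<beta> s = p \<otimes>\<^bsub>P\<^esub> \<beta> (b i))"

definition idx :: "'p \<Rightarrow> 'i"
  where "idx p = fst (SOME x. sel p x)"

text \<open>The default value is the identity, so in a fibre without a selected coordinate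
  \<open>approx\<close> leaves \<open>Q\<close> fixed and the gauge factors cancel for whatever
  index \<open>idx\<close> returns.\<close>

definition val :: "('b \<Rightarrow> 'a) \<Rightarrow> 'p \<Rightarrow> 'q"
  where "val f p = (if \<exists>x. sel p x then \<alpha> (f (snd (SOME x. sel p x))) else \<one>\<^bsub>Q\<^esub>)"

text \<open>In the fibre over \<open>p\<close> at most one coordinate of \<open>f\<close> acts: it translates \<open>Q\<close>, conjugated by
  the gauge transformation \<open>y (idx p)\<close>.\<close>

definition approx :: "('b \<Rightarrow> 'a) \<times> 'b \<Rightarrow> ('p \<times> 'q \<Rightarrow> 'p \<times> 'q) \<times> ('p \<times> 'q \<Rightarrow> 'g)"
  where "approx = (\<lambda>(f, c).
    (\<lambda>(p, r)\<in>T. (\<beta> c \<otimes>\<^bsub>P\<^esub> p, val f (\<beta> c \<otimes>\<^bsub>P\<^esub> p) \<otimes>\<^bsub>Q\<^esub> r),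
     \<lambda>(p, r)\<in>T. y (idx (\<beta> c \<otimes>\<^bsub>P\<^esub> p)) (val f (\<beta> c \<otimes>\<^bsub>P\<^esub> p) \<otimes>\<^bsub>Q\<^esub> r)
        \<otimes>\<^bsub>\<Phi>\<^esub> inv\<^bsub>\<Phi>\<^esub> y (idx (\<beta> c \<otimes>\<^bsub>P\<^esub> p)) r))"

lemma sel_unique:
  assumes "p \<in> carrier P" "sel p (i, s)"
  shows "(SOME x. sel p x) = (i, s)"
proof (rule some_equality)
  show "x = (i, s)" if "sel p x" for x
    using that assms separated[of "fst x" i "snd x" s p] by (auto simp: sel_def)
qed fact

lemma val_sel: "p \<in> carrier P \<Longrightarrow> sel p (i, s) \<Longrightarrow> val f p = \<alpha> (f s)"
  using sel_unique by (auto simp: val_def)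

lemma idx_sel: "p \<in> carrier P \<Longrightarrow> sel p (i, s) \<Longrightarrow> idx p = i"
  by (simp add: idx_def sel_unique)

lemma val_not_sel: "(\<And>i s. \<not> sel p (i, s)) \<Longrightarrow> val f p = \<one>\<^bsub>Q\<^esub>"
  by (auto simp: val_def)

lemma N_app: "f \<in> carrier N \<Longrightarrow> x \<in> carrier B \<Longrightarrow> f x \<in> carrier A"
  using A.is_group by (auto simp: carrier_sum_group)

lemma selD: "sel p (i, s) \<Longrightarrow> s \<in> carrier B"
  using S by (auto simp: sel_def)

lemma val_closed [simp]:
  assumes "f \<in> carrier N" "p \<in> carrier P"
  shows "val f p \<in> carrier Q"
  using assms val_sel[OF assms(2)] N_app selD val_not_sel
  by (metis Q.one_closed \<alpha>.hom_closed)

lemma val_mult: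
  assumes "f \<in> carrier N" "g \<in> carrier N" "p \<in> carrier P"
  shows "val (f \<otimes>\<^bsub>N\<^esub> g) p = val f p \<otimes>\<^bsub>Q\<^esub> val g p"
proof (cases "\<exists>i s. sel p (i, s)")
  case True
  then obtain i s where "sel p (i, s)" by blast
  then show ?thesis
    using assms N_app selD[of p i s] by (simp add: val_sel)
qed (simp add: val_not_sel)

lemma val_one: "p \<in> carrier P \<Longrightarrow> val \<one>\<^bsub>N\<^esub> p = \<one>\<^bsub>Q\<^esub>"
  using selD val_sel[of p] val_not_sel[of p] by (metis \<alpha>.hom_one one_sum_group restrict_apply')

text \<open>Left multiplication by \<open>c\<close> commutes with the right multiplication by
  \<open>b i\<close> used in \<open>sel\<close>, so selection is compatible with the action of
  \<open>B\<close>.\<close>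

lemma sel_translate:
  assumes "c \<in> carrier B" "p \<in> carrier P" "s \<in> carrier B" "i \<in> I"
  shows "\<beta> (c \<otimes>\<^bsub>B\<^esub> s) = \<beta> c \<otimes>\<^bsub>P\<^esub> p \<otimes>\<^bsub>P\<^esub> \<beta> (b i) \<longleftrightarrow> \<beta> s = p \<otimes>\<^bsub>P\<^esub> \<beta> (b i)"
  using assms b by (simp add: P.m_assoc)

lemma shift_mult_app:
  "c \<in> carrier B \<Longrightarrow> s \<in> carrier B \<Longrightarrow> shift B c g (c \<otimes>\<^bsub>B\<^esub> s) = g s"
  by (simp add: shift_def B.m_assoc[symmetric])

text \<open>Selection sees only coordinates in \<open>S\<close>, so each non-trivial coordinate of
  \<open>g\<close> must lie in \<open>S\<close> both before and after translation by
  \<open>c\<close>. The indices are compared only where \<open>val\<close> is non-trivial, since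
  elsewhere \<open>idx\<close> may be an arbitrary choice.\<close>

lemma val_shift:
  assumes g: "g \<in> carrier N" and c: "c \<in> carrier B" and p: "p \<in> carrier P"
    and supp: "\<And>s. \<lbrakk>s \<in> carrier B; g s \<noteq> \<one>\<^bsub>A\<^esub>\<rbrakk> \<Longrightarrow> s \<in> S \<and> c \<otimes>\<^bsub>B\<^esub> s \<in> S"
  shows "val (shift B c g) (\<beta> c \<otimes>\<^bsub>P\<^esub> p) = val g p"
    and "val g p \<noteq> \<one>\<^bsub>Q\<^esub> \<Longrightarrow> idx (\<beta> c \<otimes>\<^bsub>P\<^esub> p) = idx p"
proof -
  let ?p = "\<beta> c \<otimes>\<^bsub>P\<^esub> p"
  have p': "?p \<in> carrier P" using c p by simp
  have "val (shift B c g) ?p = val g p \<and> (val g p \<noteq> \<one>\<^bsub>Q\<^esub> \<longrightarrow> idx ?p = idx p)"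
  proof (cases "\<exists>i s. i \<in> I \<and> s \<in> carrier B \<and> \<beta> s = p \<otimes>\<^bsub>P\<^esub> \<beta> (b i) \<and> g s \<noteq> \<one>\<^bsub>A\<^esub>")
    case True
    then obtain i s where ex: "i \<in> I" "s \<in> carrier B" "\<beta> s = p \<otimes>\<^bsub>P\<^esub> \<beta> (b i)" "g s \<noteq> \<one>\<^bsub>A\<^esub>"
      by blast
    then have "sel p (i, s)" "sel ?p (i, c \<otimes>\<^bsub>B\<^esub> s)"
      using supp[of s] sel_translate[OF c p ex(2,1)] by (auto simp: sel_def)
    then show ?thesis
      using p p' c ex by (simp add: val_sel idx_sel shift_mult_app)
  next
    case False
    have 1: "val g p = \<one>\<^bsub>Q\<^esub>"
    proof (cases "\<exists>i s. sel p (i, s)")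
      case True
      then obtain i s where ex: "sel p (i, s)" by blast
      then have "g s = \<one>\<^bsub>A\<^esub>" using False selD by (auto simp: sel_def)
      then show ?thesis using val_sel[OF p ex] by simp
    qed (simp add: val_not_sel)
    have 2: "val (shift B c g) ?p = \<one>\<^bsub>Q\<^esub>"
    proof (cases "\<exists>i s. sel ?p (i, s)")
      case True
      then obtain i s where ex: "sel ?p (i, s)" by blast
      \<comment> \<open>Pulling the selected coordinate back by \<open>c\<close> brings it over
        \<open>p\<close>, where the case assumption makes \<open>g\<close> trivial.\<close>
      define t where "t = inv\<^bsub>B\<^esub> c \<otimes>\<^bsub>B\<^esub> s"
      have t: "t \<in> carrier B" "s = c \<otimes>\<^bsub>B\<^esub> t"
        using c selD[OF ex] by (simp_all add: t_def B.m_assoc[symmetric])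
      then have "g t = \<one>\<^bsub>A\<^esub>"
        using False ex sel_translate[OF c p t(1), of i] by (auto simp: sel_def)
      then have "shift B c g s = \<one>\<^bsub>A\<^esub>"
        using t c by (simp add: shift_mult_app)
      then show ?thesis using val_sel[OF p' ex] by simp
    qed (simp add: val_not_sel)
    show ?thesis using 1 2 by simp
  qed
  then show "val (shift B c g) ?p = val g p" "val g p \<noteq> \<one>\<^bsub>Q\<^esub> \<Longrightarrow> idx ?p = idx p"
    by auto
qed

section \<open>The map \<open>approx\<close> and its partial multiplicativity\<close>

lemma fst_approx:
  "p \<in> carrier P \<Longrightarrow> r \<in> carrier Q \<Longrightarrow>
    fst (approx (f, c)) (p, r) = (\<beta> c \<otimes>\<^bsub>P\<^esub> p, val f (\<beta> c \<otimes>\<^bsub>P\<^esub> p) \<otimes>\<^bsub>Q\<^esub> r)"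
  by (simp add: approx_def)

lemma snd_approx:
  "p \<in> carrier P \<Longrightarrow> r \<in> carrier Q \<Longrightarrow>
    snd (approx (f, c)) (p, r) = y (idx (\<beta> c \<otimes>\<^bsub>P\<^esub> p)) (val f (\<beta> c \<otimes>\<^bsub>P\<^esub> p) \<otimes>\<^bsub>Q\<^esub> r)
      \<otimes>\<^bsub>\<Phi>\<^esub> inv\<^bsub>\<Phi>\<^esub> y (idx (\<beta> c \<otimes>\<^bsub>P\<^esub> p)) r"
  by (simp add: approx_def)

lemma approx_closed:
  assumes f: "f \<in> carrier N" and c: "c \<in> carrier B"
  shows "approx (f, c) \<in> carrier W"
proof -
  have "bij_betw (fst (approx (f, c))) T T"
  proof (rule bij_betw_byWitness)
    \<comment> \<open>The forward map reads \<open>val f\<close> in the target fibre, so its inverse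
      reads it in the fibre where it starts.\<close>
    let ?g = "\<lambda>(p, r). (inv\<^bsub>P\<^esub> \<beta> c \<otimes>\<^bsub>P\<^esub> p, inv\<^bsub>Q\<^esub> val f p \<otimes>\<^bsub>Q\<^esub> r)"
    show "\<forall>t\<in>T. ?g (fst (approx (f, c)) t) = t"
      using f c by (auto simp: fst_approx P.m_assoc[symmetric] Q.m_assoc[symmetric])
    show "\<forall>t\<in>T. fst (approx (f, c)) (?g t) = t"
      using f c by (auto simp: fst_approx P.m_assoc[symmetric] Q.m_assoc[symmetric])
  qed (use f c in \<open>auto simp: fst_approx\<close>)
  moreover have "fst (approx (f, c)) \<in> extensional T"
    by (simp add: approx_def)
  moreover have "snd (approx (f, c)) \<in> T \<rightarrow>\<^sub>E carrier \<Phi>"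
    using f c y by (auto simp: approx_def)
  ultimately show ?thesis
    by (auto simp: perm_wreath_def Bij_def mem_Times_iff)
qed

text \<open>The translations of \<open>Q\<close> compose by \<open>val_mult\<close> and
  \<open>val_shift\<close>. The labels are quotients of gauge values at successive points and
  telescope once both use the same index.\<close>

lemma approx_mult:
  assumes f: "f \<in> carrier N" and g: "g \<in> carrier N" and c: "c \<in> carrier B" and d: "d \<in> carrier B"
    and supp: "\<And>s. \<lbrakk>s \<in> carrier B; g s \<noteq> \<one>\<^bsub>A\<^esub>\<rbrakk> \<Longrightarrow> s \<in> S \<and> c \<otimes>\<^bsub>B\<^esub> s \<in> S"
  shows "approx (f \<otimes>\<^bsub>N\<^esub> shift B c g, c \<otimes>\<^bsub>B\<^esub> d) = approx (f, c) \<otimes>\<^bsub>W\<^esub> approx (g, d)"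
proof -
  let ?L = "approx (f \<otimes>\<^bsub>N\<^esub> shift B c g, c \<otimes>\<^bsub>B\<^esub> d)" and ?R = "approx (f, c) \<otimes>\<^bsub>W\<^esub> approx (g, d)"
  have sh: "shift B c g \<in> carrier N"
    using A.is_group B.is_group c g by (rule shift_closed)
  interpret N: group N by (rule sum_group) (rule A.is_group)
  interpret W: group W by (rule group_perm_wreath) (rule \<Phi>.is_group)
  have eq: "fst ?L (p, r) = fst ?R (p, r) \<and> snd ?L (p, r) = snd ?R (p, r)"
    if p: "p \<in> carrier P" and r: "r \<in> carrier Q" for p r
  proof -
    define p2 where "p2 = \<beta> d \<otimes>\<^bsub>P\<^esub> p"
    define p3 where "p3 = \<beta> c \<otimes>\<^bsub>P\<^esub> p2"
    define q2 where "q2 = val g p2"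
    define q3 where "q3 = val f p3"
    have cl: "p2 \<in> carrier P" "p3 \<in> carrier P" "q2 \<in> carrier Q" "q3 \<in> carrier Q"
      using c d p f g by (simp_all add: p2_def p3_def q2_def q3_def)
    have p3: "\<beta> (c \<otimes>\<^bsub>B\<^esub> d) \<otimes>\<^bsub>P\<^esub> p = p3"
      using c d p by (simp add: p2_def p3_def P.m_assoc)
    have v: "val (f \<otimes>\<^bsub>N\<^esub> shift B c g) p3 = q3 \<otimes>\<^bsub>Q\<^esub> q2"
      using val_mult[OF f sh cl(2)] val_shift(1)[OF g c cl(1) supp] by (simp add: p3_def q2_def q3_def)
    have idx: "q2 \<noteq> \<one>\<^bsub>Q\<^esub> \<Longrightarrow> idx p3 = idx p2"
      using val_shift(2)[OF g c cl(1) supp] by (simp add: p3_def q2_def)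
    have L: "fst ?L (p, r) = (p3, q3 \<otimes>\<^bsub>Q\<^esub> q2 \<otimes>\<^bsub>Q\<^esub> r)"
        "snd ?L (p, r) = y (idx p3) (q3 \<otimes>\<^bsub>Q\<^esub> q2 \<otimes>\<^bsub>Q\<^esub> r) \<otimes>\<^bsub>\<Phi>\<^esub> inv\<^bsub>\<Phi>\<^esub> y (idx p3) r"
      unfolding fst_approx[OF p r] snd_approx[OF p r] p3 v by simp_all
    have g1: "fst (approx (g, d)) (p, r) = (p2, q2 \<otimes>\<^bsub>Q\<^esub> r)"
        "snd (approx (g, d)) (p, r) = y (idx p2) (q2 \<otimes>\<^bsub>Q\<^esub> r) \<otimes>\<^bsub>\<Phi>\<^esub> inv\<^bsub>\<Phi>\<^esub> y (idx p2) r"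
      unfolding fst_approx[OF p r] snd_approx[OF p r] by (simp_all add: p2_def q2_def)
    have q2r: "q2 \<otimes>\<^bsub>Q\<^esub> r \<in> carrier Q" using cl r by simp
    have f1: "fst (approx (f, c)) (p2, q2 \<otimes>\<^bsub>Q\<^esub> r) = (p3, q3 \<otimes>\<^bsub>Q\<^esub> (q2 \<otimes>\<^bsub>Q\<^esub> r))"
        "snd (approx (f, c)) (p2, q2 \<otimes>\<^bsub>Q\<^esub> r) =
          y (idx p3) (q3 \<otimes>\<^bsub>Q\<^esub> (q2 \<otimes>\<^bsub>Q\<^esub> r)) \<otimes>\<^bsub>\<Phi>\<^esub> inv\<^bsub>\<Phi>\<^esub> y (idx p3) (q2 \<otimes>\<^bsub>Q\<^esub> r)"
      unfolding fst_approx[OF cl(1) q2r] snd_approx[OF cl(1) q2r] by (simp_all add: p3_def q3_def)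
    have pr: "(p, r) \<in> T" using p r by simp
    note R = perm_wreath_apply[OF approx_closed[OF f c] approx_closed[OF g d] pr]
    have "snd ?R (p, r) = y (idx p3) (q3 \<otimes>\<^bsub>Q\<^esub> (q2 \<otimes>\<^bsub>Q\<^esub> r)) \<otimes>\<^bsub>\<Phi>\<^esub> inv\<^bsub>\<Phi>\<^esub> y (idx p3) (q2 \<otimes>\<^bsub>Q\<^esub> r)
        \<otimes>\<^bsub>\<Phi>\<^esub> (y (idx p2) (q2 \<otimes>\<^bsub>Q\<^esub> r) \<otimes>\<^bsub>\<Phi>\<^esub> inv\<^bsub>\<Phi>\<^esub> y (idx p2) r)"
      using R(2) g1 f1 by simp
    also have "\<dots> = y (idx p3) (q3 \<otimes>\<^bsub>Q\<^esub> (q2 \<otimes>\<^bsub>Q\<^esub> r)) \<otimes>\<^bsub>\<Phi>\<^esub> inv\<^bsub>\<Phi>\<^esub> y (idx p3) r"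
    \<comment> \<open>If \<open>q2\<close> is trivial, the second label is trivial for every index;
      otherwise the two indices agree and the inner gauge values cancel.\<close>
    proof (cases "q2 = \<one>\<^bsub>Q\<^esub>")
      case True
      then show ?thesis using cl r y by simp
    next
      case False
      have "inv\<^bsub>\<Phi>\<^esub> y (idx p2) (q2 \<otimes>\<^bsub>Q\<^esub> r) \<otimes>\<^bsub>\<Phi>\<^esub> (y (idx p2) (q2 \<otimes>\<^bsub>Q\<^esub> r) \<otimes>\<^bsub>\<Phi>\<^esub> inv\<^bsub>\<Phi>\<^esub> y (idx p2) r)
          = inv\<^bsub>\<Phi>\<^esub> y (idx p2) r"
        using q2r r y by (simp add: \<Phi>.m_assoc[symmetric])
      then show ?thesis
        unfolding idx[OF False] using q2r cl r y by (simp add: \<Phi>.m_assoc)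
    qed
    finally show ?thesis
      using L R(1) g1 f1 cl r by (simp add: Q.m_assoc)
  qed
  have L: "?L \<in> carrier W"
    using f sh c d by (intro approx_closed N.m_closed B.m_closed)
  have R: "?R \<in> carrier W"
    using f g c d by (intro W.m_closed approx_closed)
  have "fst ?L = fst ?R"
    using L R eq by (intro extensionalityI[of _ T])
      (auto simp del: mult_sum_group simp: perm_wreath_def mem_Times_iff dest!: Bij_imp_extensional)
  moreover have "snd ?L = snd ?R"
    using L R eq by (intro extensionalityI[of _ T])
      (auto simp del: mult_sum_group simp: perm_wreath_def mem_Times_iff PiE_iff)
  ultimately show ?thesis
    by (rule prod_eqI)
qed

text \<open>The identity of the base group has empty support, so the support condition of
  \<open>approx_mult\<close> is vacuous: on \<open>B\<close> the approximation is exact.\<close>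

lemma approx_one_hom: "(\<lambda>c. approx (\<one>\<^bsub>N\<^esub>, c)) \<in> hom B W"
proof (rule homI)
  interpret N: group N by (rule sum_group) (rule A.is_group)
  show "approx (\<one>\<^bsub>N\<^esub>, c) \<in> carrier W" if "c \<in> carrier B" for c
    using that by (intro approx_closed N.one_closed)
  show "approx (\<one>\<^bsub>N\<^esub>, c \<otimes>\<^bsub>B\<^esub> d) = approx (\<one>\<^bsub>N\<^esub>, c) \<otimes>\<^bsub>W\<^esub> approx (\<one>\<^bsub>N\<^esub>, d)"
    if "c \<in> carrier B" "d \<in> carrier B" for c d
  proof -
    have "\<one>\<^bsub>N\<^esub> \<otimes>\<^bsub>N\<^esub> shift B c \<one>\<^bsub>N\<^esub> = \<one>\<^bsub>N\<^esub>"
      using that by (auto simp: shift_def fun_eq_iff)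
    then show ?thesis
      using approx_mult[OF N.one_closed N.one_closed that] by simp
  qed
qed

text \<open>The inverse of \<open>b i\<close> carries the fibre over the identity to one where
  coordinate \<open>\<one>\<close> acts with gauge \<open>y i\<close>, and \<open>b i\<close>
  carries it back. Thus one element of \<open>A\<close> acts over the identity through each of the
  gauges.\<close>

lemma approx_conj_delta:
  assumes i: "i \<in> I" and S1: "\<one>\<^bsub>B\<^esub> \<in> S" and a: "a \<in> carrier A" and r: "r \<in> carrier Q"
  defines "u \<equiv> approx (\<one>\<^bsub>N\<^esub>, b i) \<otimes>\<^bsub>W\<^esub> (approx (delta A B a, \<one>\<^bsub>B\<^esub>) \<otimes>\<^bsub>W\<^esub> approx (\<one>\<^bsub>N\<^esub>, inv\<^bsub>B\<^esub> b i))"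
  shows "fst u (\<one>\<^bsub>P\<^esub>, r) = (\<one>\<^bsub>P\<^esub>, \<alpha> a \<otimes>\<^bsub>Q\<^esub> r)"
    and "snd u (\<one>\<^bsub>P\<^esub>, r) = y i (\<alpha> a \<otimes>\<^bsub>Q\<^esub> r) \<otimes>\<^bsub>\<Phi>\<^esub> inv\<^bsub>\<Phi>\<^esub> y i r"
proof -
  interpret N: group N by (rule sum_group) (rule A.is_group)
  interpret W: group W by (rule group_perm_wreath) (rule \<Phi>.is_group)
  define p where "p = inv\<^bsub>P\<^esub> \<beta> (b i)"
  have p: "p \<in> carrier P" using b[OF i] by (simp add: p_def)
  have "sel p (i, \<one>\<^bsub>B\<^esub>)"
    using i S1 b[OF i] by (simp add: sel_def p_def)
  then have val: "val (delta A B a) p = \<alpha> a" and idx: "idx p = i"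
    using val_sel[OF p] idx_sel[OF p] by (auto simp: delta_def)
  let ?x = "approx (\<one>\<^bsub>N\<^esub>, b i)" and ?d = "approx (delta A B a, \<one>\<^bsub>B\<^esub>)"
    and ?z = "approx (\<one>\<^bsub>N\<^esub>, inv\<^bsub>B\<^esub> b i)"
  have cl: "?x \<in> carrier W" "?d \<in> carrier W" "?z \<in> carrier W" "?d \<otimes>\<^bsub>W\<^esub> ?z \<in> carrier W"
    using i b a A.is_group by (auto intro!: approx_closed N.one_closed delta_closed W.m_closed simp del: one_sum_group)
  have T1: "(\<one>\<^bsub>P\<^esub>, r) \<in> T" using r by simp
  have ar: "\<alpha> a \<otimes>\<^bsub>Q\<^esub> r \<in> carrier Q" using a r by simp
  have z: "fst ?z (\<one>\<^bsub>P\<^esub>, r) = (p, r)" "snd ?z (\<one>\<^bsub>P\<^esub>, r) = \<one>\<^bsub>\<Phi>\<^esub>"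
    using i b r p y by (simp_all add: fst_approx snd_approx val_one p_def[symmetric] del: one_sum_group)
  have d: "fst ?d (p, r) = (p, \<alpha> a \<otimes>\<^bsub>Q\<^esub> r)"
      "snd ?d (p, r) = y i (\<alpha> a \<otimes>\<^bsub>Q\<^esub> r) \<otimes>\<^bsub>\<Phi>\<^esub> inv\<^bsub>\<Phi>\<^esub> y i r"
    using p r val idx by (simp_all add: fst_approx snd_approx)
  have x: "fst ?x (p, \<alpha> a \<otimes>\<^bsub>Q\<^esub> r) = (\<one>\<^bsub>P\<^esub>, \<alpha> a \<otimes>\<^bsub>Q\<^esub> r)" "snd ?x (p, \<alpha> a \<otimes>\<^bsub>Q\<^esub> r) = \<one>\<^bsub>\<Phi>\<^esub>"
    using i b p ar y by (simp_all add: fst_approx snd_approx val_one p_def del: one_sum_group)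
  have dz: "fst (?d \<otimes>\<^bsub>W\<^esub> ?z) (\<one>\<^bsub>P\<^esub>, r) = (p, \<alpha> a \<otimes>\<^bsub>Q\<^esub> r)"
      "snd (?d \<otimes>\<^bsub>W\<^esub> ?z) (\<one>\<^bsub>P\<^esub>, r) = y i (\<alpha> a \<otimes>\<^bsub>Q\<^esub> r) \<otimes>\<^bsub>\<Phi>\<^esub> inv\<^bsub>\<Phi>\<^esub> y i r"
    unfolding perm_wreath_apply[OF cl(2,3) T1] z d using y r ar by simp_all
  show "fst u (\<one>\<^bsub>P\<^esub>, r) = (\<one>\<^bsub>P\<^esub>, \<alpha> a \<otimes>\<^bsub>Q\<^esub> r)"
    and "snd u (\<one>\<^bsub>P\<^esub>, r) = y i (\<alpha> a \<otimes>\<^bsub>Q\<^esub> r) \<otimes>\<^bsub>\<Phi>\<^esub> inv\<^bsub>\<Phi>\<^esub> y i r"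
    unfolding u_def perm_wreath_apply[OF cl(1,4) T1] dz x using y r ar by simp_all
qed

end

section \<open>Assembly: choice of the quotients and gauges, and surjectivity from a
  stabiliser\<close>

theorem theorem1p5:
  fixes A :: "('a, 'k) monoid_scheme"
    and B :: "('b, 'l) monoid_scheme"
    and H :: "('h, 'm) monoid_scheme"
  assumes "group A" and "finitely_generated A"
    and "group B" and "finitely_generated B"
    and "infinite (carrier B)" and "residually_finite B"
    and "\<exists>N. N \<lhd> A \<and> finite (carrier (A Mod N)) \<and> \<not> trivial_group (A Mod N)"
    and "group H" and "finitely_presented H"
    and "\<exists>f. f \<in> epi H (wreath_product A B)"
  shows "\<exists>K. finite_index K H \<and>
           (\<exists>(X :: nat set) \<phi>. \<not> comm_group (free_group X) \<and>
              \<phi> \<in> epi (H\<lparr>carrier := K\<rparr>) (free_group X))"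
proof -
  define G where "G = wreath_product A B"
  define D where "D = sum_group (carrier B) (\<lambda>_. A)"
  interpret A: group A by fact
  interpret B: group B by fact
  interpret H: group H by fact
  interpret G: group G unfolding G_def by (rule group_wreath_product) fact+
  interpret D: group D unfolding D_def by (rule sum_group) (rule A.is_group)
  have carrier_G: "carrier G = carrier D \<times> carrier B"
    and mult_G: "(f, c) \<otimes>\<^bsub>G\<^esub> (g, d) = (f \<otimes>\<^bsub>D\<^esub> shift B c g, c \<otimes>\<^bsub>B\<^esub> d)" for f g c d
    by (simp_all add: G_def D_def wreath_product_def semidirect_product_def del: mult_sum_group)
  obtain M where "M \<lhd> A" and fin_Q: "finite (carrier (A Mod M))" and "\<not> trivial_group (A Mod M)"
    using assms(7) by blast
  interpret M: normal M A by fact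
  define Q where "Q = A Mod M"
  define \<alpha> where "\<alpha> = (\<lambda>x. M #>\<^bsub>A\<^esub> x)"
  interpret Q: group Q unfolding Q_def by (rule M.factorgroup_is_group)
  interpret \<alpha>: group_hom A Q \<alpha>
    unfolding Q_def \<alpha>_def
    by (simp add: group_hom_def group_hom_axioms_def A.is_group M.factorgroup_is_group M.r_coset_hom_Mod)
  obtain a where a: "a \<in> carrier A" "\<alpha> a \<noteq> \<one>\<^bsub>Q\<^esub>"
    using \<open>\<not> trivial_group (A Mod M)\<close> Q.trivial_group_subset by (auto simp: Q_def \<alpha>_def carrier_FactGroup)
  obtain Y where Y: "finite Y" "Y \<subseteq> carrier B" "generate B Y = carrier B"
    using assms(4) by (auto simp: finitely_generated_def)
  obtain \<eta> where \<eta>: "\<eta> \<in> epi H G"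
    using assms(10) by (auto simp: G_def)
  \<comment> \<open>These are the elements whose lifts to \<open>H\<close> must act exactly as
    \<open>approx\<close> prescribes: one element of the base group and finitely many generators of
    \<open>B\<close>.\<close>
  define C where "C = insert (delta A B a, \<one>\<^bsub>B\<^esub>) ((\<lambda>c. (\<one>\<^bsub>D\<^esub>, c)) ` Y)"
  have C: "finite C" "C \<subseteq> carrier G"
    using Y(1,2) delta_closed[OF A.is_group a(1), of B] D.one_closed
    by (auto simp: C_def carrier_G D_def[symmetric])
  \<comment> \<open>The type of \<open>W\<close> anticipates the target: points are pairs of cosets,
    in \<open>B\<close> and in \<open>A\<close>, and labels are words.\<close>
  obtain E where E: "finite E" "E \<subseteq> carrier G \<times> carrier G"
    and lift: "\<forall>(W :: (('b set \<times> 'a set \<Rightarrow> 'b set \<times> 'a set) \<times> ('b set \<times> 'a set \<Rightarrow> nat letter list)) monoid) \<Psi>.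
      group W \<longrightarrow> \<Psi> \<in> carrier G \<rightarrow> carrier W \<longrightarrow>
        (\<forall>(x, y)\<in>E. \<Psi> (x \<otimes>\<^bsub>G\<^esub> y) = \<Psi> x \<otimes>\<^bsub>W\<^esub> \<Psi> y) \<longrightarrow>
        (\<exists>\<theta>\<in>hom H W. \<forall>c\<in>C. \<exists>h\<in>carrier H. \<eta> h = c \<and> \<theta> h = \<Psi> c)"
    by (rule finitely_presented_local_hom[OF H.is_group assms(9) G.is_group \<eta> C])
  define supp where "supp g = {s \<in> carrier B. g s \<noteq> \<one>\<^bsub>A\<^esub>}" for g
  \<comment> \<open>The supports and their translates are what \<open>approx_mult\<close> requires
    for the pairs in \<open>E\<close>; the identity is added for
    \<open>approx_conj_delta\<close>.\<close>
  define S where "S = insert \<one>\<^bsub>B\<^esub> (\<Union>((f, c), (g, d))\<in>E. supp g \<union> (\<lambda>s. c \<otimes>\<^bsub>B\<^esub> s) ` supp g)"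
  have "finite (supp g)" if "g \<in> carrier D" for g
    using that A.is_group by (simp add: D_def supp_def carrier_sum_group)
  then have S: "finite S" "S \<subseteq> carrier B"
    using E by (auto simp: S_def supp_def carrier_G)
  obtain N and b :: "nat \<Rightarrow> 'b" where N: "N \<lhd> B" "finite_index N B" and "\<forall>i. b i \<in> carrier B"
    and sep: "\<forall>i<3. \<forall>j<3. \<forall>s\<in>S. \<forall>t\<in>S. \<forall>p\<in>carrier (B Mod N).
        N #>\<^bsub>B\<^esub> s = p \<otimes>\<^bsub>B Mod N\<^esub> (N #>\<^bsub>B\<^esub> b i) \<longrightarrow> N #>\<^bsub>B\<^esub> t = p \<otimes>\<^bsub>B Mod N\<^esub> (N #>\<^bsub>B\<^esub> b j)
        \<longrightarrow> i = j \<and> s = t"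
    by (rule B.residually_finite_translates[OF assms(5,6) S])
  then have b: "b i \<in> carrier B" for i
    by blast
  interpret N: normal N B by (rule N)
  define P where "P = B Mod N"
  define \<beta> where "\<beta> = (\<lambda>x. N #>\<^bsub>B\<^esub> x)"
  define \<Phi> where "\<Phi> = free_group {0, 1::nat}"
  \<comment> \<open>Gauges 0 and 1 place a free generator at the single point
    \<open>\<alpha> a\<close>; gauge 2 is trivial and serves as reference. All are trivial at the
    identity because \<open>\<alpha> a\<close> differs from it.\<close>
  define y :: "nat \<Rightarrow> 'a set \<Rightarrow> nat letter list" where "y i r = (if i < 2 \<and> r = \<alpha> a then [(i, True)] else [])" for i r
  have fin_P: "finite (carrier P)"
    using N(2) by (simp add: P_def FactGroup_def finite_index_def)
  interpret \<Phi>: group \<Phi> unfolding \<Phi>_def by (rule group_free_group)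
  interpret P: group P unfolding P_def by (rule N.factorgroup_is_group)
  interpret \<beta>: group_hom B P \<beta>
    unfolding P_def \<beta>_def
    by (simp add: group_hom_def group_hom_axioms_def B.is_group N.factorgroup_is_group N.r_coset_hom_Mod)
  interpret wreath_approx A B Q P \<Phi> \<alpha> \<beta> S "{..<3}" b y
  proof
    show "y i r \<in> carrier \<Phi>" for i r
      by (auto simp: y_def \<Phi>_def carrier_free_group reduced_def)
    show "i = j \<and> s = t" if "i \<in> {..<3}" "j \<in> {..<3}" "s \<in> S" "t \<in> S" "p \<in> carrier P"
      "\<beta> s = p \<otimes>\<^bsub>P\<^esub> \<beta> (b i)" "\<beta> t = p \<otimes>\<^bsub>P\<^esub> \<beta> (b j)" for i j s t p
      using sep[rule_format, of i j s t p] that by (simp add: P_def \<beta>_def)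
  qed (use S(2) b in auto)
  interpret W: group W by (rule group_perm_wreath) (rule \<Phi>.is_group)
  have approx_G: "approx \<in> carrier G \<rightarrow> carrier W"
    using approx_closed by (auto simp: carrier_G D_def)
  have approx_E: "approx (x \<otimes>\<^bsub>G\<^esub> z) = approx x \<otimes>\<^bsub>W\<^esub> approx z" if "(x, z) \<in> E" for x z
  proof -
    obtain f c g d where xz: "x = (f, c)" "z = (g, d)" by (cases x, cases z)
    have E_fcgd: "((f, c), (g, d)) \<in> E"
      using that xz by simp
    have cl: "f \<in> carrier D" "g \<in> carrier D" "c \<in> carrier B" "d \<in> carrier B"
      using that E(2) by (auto simp: xz carrier_G)
    have supp_S: "s \<in> S \<and> c \<otimes>\<^bsub>B\<^esub> s \<in> S" if "s \<in> carrier B" "g s \<noteq> \<one>\<^bsub>A\<^esub>" for s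
    proof -
      have "s \<in> supp g" using that by (simp add: supp_def)
      then have "s \<in> supp g \<union> (\<lambda>s. c \<otimes>\<^bsub>B\<^esub> s) ` supp g" "c \<otimes>\<^bsub>B\<^esub> s \<in> supp g \<union> (\<lambda>s. c \<otimes>\<^bsub>B\<^esub> s) ` supp g"
        by simp_all
      then show ?thesis
        unfolding S_def using E_fcgd by (auto intro!: bexI[of _ "((f, c), (g, d))"])
    qed
    show ?thesis
      unfolding xz mult_G D_def using cl[unfolded D_def] supp_S by (rule approx_mult)
  qed
  have "\<exists>\<theta>\<in>hom H W. \<forall>c\<in>C. \<exists>h\<in>carrier H. \<eta> h = c \<and> \<theta> h = approx c"
    by (rule lift[THEN spec, THEN spec, THEN mp, THEN mp, THEN mp, OF W.is_group approx_G])
      (clarify, rule approx_E)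
  then obtain \<theta> where \<theta>: "\<theta> \<in> hom H W"
    and \<theta>C: "\<And>c. c \<in> C \<Longrightarrow> \<exists>h\<in>carrier H. \<eta> h = c \<and> \<theta> h = approx c"
    by blast
  interpret \<theta>: group_hom H W \<theta>
    using \<theta> by (simp add: group_hom_def group_hom_axioms_def H.is_group W.is_group)
  define L where "L = \<theta> ` carrier H"
  have L: "subgroup L W"
    unfolding L_def by (rule \<theta>.img_is_subgroup)
  have approx_C: "approx c \<in> L" if "c \<in> C" for c
    using \<theta>C[OF that] unfolding L_def by (metis image_eqI)
  interpret j: group_hom B W "\<lambda>c. approx (\<one>\<^bsub>D\<^esub>, c)"
    unfolding D_def
    using approx_one_hom by (simp add: group_hom_def group_hom_axioms_def B.is_group W.is_group)
  \<comment> \<open>\<open>\<theta>\<close> is tied to \<open>approx\<close> only on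
    \<open>C\<close>, but \<open>approx\<close> is a homomorphism on \<open>B\<close>, so the
    generators carry all of \<open>B\<close> into \<open>L\<close>.\<close>
  have "approx (\<one>\<^bsub>D\<^esub>, c) \<in> L" if "c \<in> carrier B" for c
  proof -
    have "(\<lambda>c. approx (\<one>\<^bsub>D\<^esub>, c)) ` Y \<subseteq> L"
      using approx_C by (auto simp: C_def)
    then have "generate W ((\<lambda>c. approx (\<one>\<^bsub>D\<^esub>, c)) ` Y) \<subseteq> L"
      using L by (rule W.generate_subgroup_incl)
    then show ?thesis
      using j.generate_img[OF Y(2)] that Y(3) by blast
  qed
  note approx_B = this
  define u where "u i = approx (\<one>\<^bsub>D\<^esub>, b i) \<otimes>\<^bsub>W\<^esub> (approx (delta A B a, \<one>\<^bsub>B\<^esub>) \<otimes>\<^bsub>W\<^esub> approx (\<one>\<^bsub>D\<^esub>, inv\<^bsub>B\<^esub> b i))" for i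
  have uL: "u i \<in> L" if "i < 3" for i
    unfolding u_def using approx_B b[of i] that approx_C
    by (intro subgroup.m_closed[OF L]) (auto simp: C_def simp del: j.hom_inv)
  define t where "t = (\<one>\<^bsub>P\<^esub>, \<one>\<^bsub>Q\<^esub>)"
  \<comment> \<open>The three elements move \<open>t\<close> to one common point, with labels the
    two free generators and the identity.\<close>
  have u: "fst (u i) t = (\<one>\<^bsub>P\<^esub>, \<alpha> a)" "snd (u i) t = y i (\<alpha> a)" if "i < 3" for i
  proof -
    have "y i \<one>\<^bsub>Q\<^esub> = \<one>\<^bsub>\<Phi>\<^esub>" for i
      using a(2) by (auto simp: y_def \<Phi>_def one_free_group)
    then show "fst (u i) t = (\<one>\<^bsub>P\<^esub>, \<alpha> a)" "snd (u i) t = y i (\<alpha> a)"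
      using approx_conj_delta[of i a "\<one>\<^bsub>Q\<^esub>"] that a(1) y
      by (simp_all add: u_def t_def S_def D_def del: one_sum_group)
  qed
  define K where "K = {h \<in> carrier H. fst (\<theta> h) t = t}"
  define \<phi> where "\<phi> h = snd (\<theta> h) t" for h
  have fin_T: "finite T" "t \<in> T"
    using fin_P fin_Q[folded Q_def] Q.one_closed by (auto simp: t_def)
  have K: "finite_index K H" and \<phi>: "\<phi> \<in> hom (H\<lparr>carrier := K\<rparr>) \<Phi>"
    using perm_wreath_stabilizer[OF H.is_group \<Phi>.is_group \<theta> fin_T] by (simp_all add: K_def \<phi>_def[abs_def])
  have "group (H\<lparr>carrier := K\<rparr>)"
    using K H.is_group by (simp add: finite_index_def subgroup.subgroup_is_group)
  then interpret \<phi>: group_hom "H\<lparr>carrier := K\<rparr>" \<Phi> \<phi>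
    using \<phi> by (simp add: group_hom_def group_hom_axioms_def \<Phi>.is_group)
  have "[(i, True)] \<in> \<phi> ` K" if "i \<in> {0, 1}" for i
  proof -
    have i: "i < 3" using that by auto
    have cl: "u 2 \<in> carrier W" "u i \<in> carrier W"
      using uL[of 2] uL[OF i] subgroup.subset[OF L] by auto
    \<comment> \<open>Dividing by the reference element \<open>u 2\<close> returns \<open>t\<close>
      to itself and leaves the generator \<open>i\<close> as label.\<close>
    have "inv\<^bsub>W\<^esub> u 2 \<otimes>\<^bsub>W\<^esub> u i \<in> L"
      using uL[of 2] uL[OF i] by (simp add: subgroup.m_closed[OF L] subgroup.m_inv_closed[OF L])
    then obtain h where h: "h \<in> carrier H" "\<theta> h = inv\<^bsub>W\<^esub> u 2 \<otimes>\<^bsub>W\<^esub> u i"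
      by (auto simp: L_def)
    note * = perm_wreath_inv_apply[OF \<Phi>.is_group cl fin_T(2)]
    have "h \<in> K"
      using h *(1) u[of 2] u[OF i] by (simp add: K_def)
    moreover have "\<phi> h = [(i, True)]"
    proof -
      have "y 2 (\<alpha> a) = \<one>\<^bsub>\<Phi>\<^esub>" "y i (\<alpha> a) = [(i, True)]"
        using that by (auto simp: y_def \<Phi>_def one_free_group)
      moreover have "[(i, True)] \<in> carrier \<Phi>"
        using that by (simp add: \<Phi>_def singleton_in_free_group)
      ultimately show ?thesis
        using h *(2) u[of 2] u[OF i] by (simp add: \<phi>_def)
    qed
    ultimately show ?thesis by (metis image_eqI)
  qed
  then have "\<phi> ` K = carrier \<Phi>"
    using \<phi>.img_is_subgroup unfolding \<Phi>_def by (intro free_group_subgroup_eq) auto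
  then have "\<phi> \<in> epi (H\<lparr>carrier := K\<rparr>) \<Phi>"
    using \<phi> by (simp add: epi_def)
  moreover have "\<not> comm_group \<Phi>"
    unfolding \<Phi>_def by (rule free_group_not_comm[of 0 _ 1]) auto
  ultimately show ?thesis
    using K unfolding \<Phi>_def by blast
qed

end
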